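(* Let $\Delta$ be a simplicial complex on ground set $[n]$ and let $\mathcal C(\Delta)$ be the cone over $\Delta$, i.e. the simplicial complex on $[n]\cup\{\ell\}$ (with $\ell\notin[n]$) with facets $\{F\cup\{\ell\} : F\in\mathrm{facets}(\Delta)\}$. Then $$\deg(I(\mathcal C(\Delta)))=\deg(I(\Delta))^2.$$
   Context: A simplicial complex $\Delta$ on a finite ground set $V$ is a nonempty family of subsets of $V$ closed under taking subsets; $\mathrm{facets}(\Delta)$ is its set of inclusion-maximal elements. Let $\mathbb K$ be a field. The toric ideal $I(\Delta)$ of the binary hierarchical model of $\Delta$ (ground set $V$) is the kernel of the $\mathbb K$-algebra homomorphism $$f_\Delta:\mathbb K[p_S : S\subset V]\to\mathbb K[\theta_{(H,F)} : H\subset F\in\mathrm{facets}(\Delta)],\qquad p_S\mapsto\prod_{F\in\mathrm{facets}(\Delta)}\theta_{(S\cap F,F)}.$$ It is homogeneous for the standard grading on $R=\mathbb K[p_S : S\subset V]$. Writing the Hilbert series of $R/I(\Delta)$ as $\sum_{d\ge0}\dim_{\mathbb K}[R/I(\Delta)]_d\,t^d=k(t)/(1-t)^{\dim(R/I(\Delta))}$ with $k(t)\in\mathbb Z[t]$, $k(1)>0$, the degree of $I(\Delta)$ is $\deg(I(\Delta))=k(1)$. *)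

theory Defs
  imports
    "HOL-Library.Poly_Mapping"
    "HOL-Library.Extended_Nat"
    "HOL-Computational_Algebra.Polynomial_FPS"
    "HOL-Algebra.QuotRing"
    "HOL-Algebra.Embedded_Algebras"
begin

section \<open>Simplicial complexes and cones\<close>

definition simplicial_complex :: "'a set \<Rightarrow> 'a set set \<Rightarrow> bool" where
  "simplicial_complex V \<Delta> \<longleftrightarrow>
     finite V \<and> \<Delta> \<noteq> {} \<and> \<Delta> \<subseteq> Pow V \<and> (\<forall>F\<in>\<Delta>. \<forall>G. G \<subseteq> F \<longrightarrow> G \<in> \<Delta>)"

definition facets :: "'a set set \<Rightarrow> 'a set set" where
  "facets \<Delta> = {F \<in> \<Delta>. \<forall>G\<in>\<Delta>. F \<subseteq> G \<longrightarrow> F = G}"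

definition cone :: "'a \<Rightarrow> 'a set set \<Rightarrow> 'a set set" where
  "cone l \<Delta> = {G. \<exists>F\<in>facets \<Delta>. G \<subseteq> insert l F}"

text \<open>Lemmas \<open>simplicial_complex_cone\<close>, \<open>facets_cone\<close> and \<open>cone_unique\<close> say that
  \<open>cone l \<Delta>\<close> is the unique simplicial complex on \<open>insert l V\<close> whose facets are the
  sets \<open>insert l F\<close> with \<open>F\<close> a facet of \<open>\<Delta>\<close>.\<close>

lemma face_in_facet:
  assumes "simplicial_complex V \<Delta>" "G \<in> \<Delta>"
  shows "\<exists>F\<in>facets \<Delta>. G \<subseteq> F"
proof -
  have "finite \<Delta>"
    using assms(1) unfolding simplicial_complex_def by (meson finite_Pow_iff finite_subset)
  then obtain F where "F \<in> \<Delta>" "G \<subseteq> F" "\<forall>H\<in>\<Delta>. F \<subseteq> H \<longrightarrow> F = H"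
    using finite_has_maximal2[of \<Delta> G] assms(2) by auto
  then show ?thesis by (auto simp: facets_def)
qed

lemma simplicial_complex_cone:
  assumes "simplicial_complex V \<Delta>"
  shows "simplicial_complex (insert l V) (cone l \<Delta>)"
proof -
  obtain G where "G \<in> \<Delta>" using assms unfolding simplicial_complex_def by blast
  then obtain F where F: "F \<in> facets \<Delta>" using face_in_facet[OF assms] by blast
  have sub: "F' \<subseteq> V" if "F' \<in> facets \<Delta>" for F'
    using that assms by (auto simp: simplicial_complex_def facets_def)
  have "F \<in> cone l \<Delta>" using F by (auto simp: cone_def)
  moreover have "cone l \<Delta> \<subseteq> Pow (insert l V)"
    using sub by (fastforce simp: cone_def)
  moreover have "\<forall>G\<in>cone l \<Delta>. \<forall>H. H \<subseteq> G \<longrightarrow> H \<in> cone l \<Delta>"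
    unfolding cone_def by (auto intro: subset_trans)
  moreover have "finite (insert l V)" using assms by (simp add: simplicial_complex_def)
  ultimately show ?thesis unfolding simplicial_complex_def by auto
qed

lemma facets_cone:
  assumes "simplicial_complex V \<Delta>" "l \<notin> V"
  shows "facets (cone l \<Delta>) = insert l ` facets \<Delta>"
proof -
  have l: "l \<notin> F" if "F \<in> facets \<Delta>" for F
    using that assms unfolding simplicial_complex_def facets_def by blast
  have max: "F = G" if "F \<in> facets \<Delta>" "G \<in> facets \<Delta>" "F \<subseteq> G" for F G
    using that unfolding facets_def by blast
  show ?thesis
  proof (intro Set.set_eqI iffI)
    fix A assume A: "A \<in> facets (cone l \<Delta>)"
    then obtain F where F: "F \<in> facets \<Delta>" "A \<subseteq> insert l F"
      unfolding facets_def cone_def by blast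
    then have "insert l F \<in> cone l \<Delta>" unfolding cone_def by blast
    with A F have "A = insert l F" unfolding facets_def by blast
    with F show "A \<in> insert l ` facets \<Delta>" by blast
  next
    fix A assume "A \<in> insert l ` facets \<Delta>"
    then obtain F where F: "F \<in> facets \<Delta>" "A = insert l F" by blast
    have "A = G" if G: "G \<in> cone l \<Delta>" "A \<subseteq> G" for G
    proof -
      obtain F' where F': "F' \<in> facets \<Delta>" "G \<subseteq> insert l F'"
        using G unfolding cone_def by blast
      have "F \<subseteq> F'" using F F' G l[OF F(1)] by blast
      then have "F = F'" using max F F' by blast
      then show ?thesis using F F' G by blast
    qed
    moreover have "A \<in> cone l \<Delta>" using F unfolding cone_def by blast
    ultimately show "A \<in> facets (cone l \<Delta>)" unfolding facets_def by blast
  qed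
qed

lemma cone_unique:
  assumes "simplicial_complex (insert l V) \<Gamma>" "facets \<Gamma> = insert l ` facets \<Delta>"
  shows "\<Gamma> = cone l \<Delta>"
proof (intro Set.set_eqI iffI)
  fix A assume "A \<in> \<Gamma>"
  then obtain F where "F \<in> facets \<Gamma>" "A \<subseteq> F" using face_in_facet[OF assms(1)] by blast
  then show "A \<in> cone l \<Delta>" using assms(2) by (auto simp: cone_def)
next
  fix A assume "A \<in> cone l \<Delta>"
  then obtain F where F: "A \<subseteq> insert l F" "F \<in> facets \<Delta>" by (auto simp: cone_def)
  then have "insert l F \<in> facets \<Gamma>" using assms(2) by simp
  then have "insert l F \<in> \<Gamma>" by (simp add: facets_def)
  then show "A \<in> \<Gamma>" using F(1) assms(1) by (simp add: simplicial_complex_def)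
qed


section \<open>Multivariate polynomials\<close>

text \<open>A monomial is an exponent vector of type \<open>'x \<Rightarrow>\<^sub>0 nat\<close>, a polynomial a finitely supported
  function from monomials to coefficients. \<open>poly_ring X\<close> is \<open>\<bbbK>[x : x \<in> X]\<close>, for \<open>\<bbbK>\<close> the
  field given by the type \<open>'k\<close>.\<close>

type_synonym ('x, 'k) mpoly = "('x \<Rightarrow>\<^sub>0 nat) \<Rightarrow>\<^sub>0 'k"

definition poly_ring :: "'x set \<Rightarrow> ('x, 'k::field) mpoly ring" where
  "poly_ring X =
     \<lparr>carrier = {p. \<forall>m\<in>Poly_Mapping.keys p. Poly_Mapping.keys m \<subseteq> X}, mult = (*), one = 1, zero = 0, add = (+)\<rparr>"

definition const :: "'k::field \<Rightarrow> ('x, 'k) mpoly" where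
  "const c = Poly_Mapping.single 0 c"

definition var :: "'x \<Rightarrow> ('x, 'k::field) mpoly" where
  "var x = Poly_Mapping.single (Poly_Mapping.single x 1) 1"

text \<open>The \<open>\<bbbK>\<close>-algebra homomorphism sending each variable \<open>x\<close> to \<open>f x\<close>.\<close>

definition poly_hom :: "('x \<Rightarrow> ('y, 'k::field) mpoly) \<Rightarrow> ('x, 'k) mpoly \<Rightarrow> ('y, 'k) mpoly" where
  "poly_hom f p = (\<Sum>m\<in>Poly_Mapping.keys p.
     const (Poly_Mapping.lookup p m) * (\<Prod>x\<in>Poly_Mapping.keys m. f x ^ Poly_Mapping.lookup m x))"

text \<open>Lemmas \<open>poly_hom_const\<close>, \<open>poly_hom_var\<close> and \<open>poly_hom_ring_hom\<close> confirm that description;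
  they also give that the toric ideal below is an ideal.\<close>

lemma const_mult: "const (a * b) = (const a * const b :: ('x, 'k::field) mpoly)"
  by (simp add: const_def mult_single)

lemma const_add: "const (a + b) = (const a + const b :: ('x, 'k::field) mpoly)"
  by (simp add: const_def single_add)

lemma mpoly_expand:
  "(p :: ('x, 'k::field) mpoly) =
     (\<Sum>m\<in>Poly_Mapping.keys p. Poly_Mapping.single m (Poly_Mapping.lookup p m))"
proof (rule poly_mapping_eqI)
  fix k
  show "Poly_Mapping.lookup p k = Poly_Mapping.lookup
          (\<Sum>m\<in>Poly_Mapping.keys p. Poly_Mapping.single m (Poly_Mapping.lookup p m)) k"
    by (simp add: lookup_sum lookup_single when_def sum.delta' not_in_keys_iff_lookup_eq_zero)
qed

lemma poly_hom_superset:
  assumes "finite A" "Poly_Mapping.keys p \<subseteq> A"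
  shows "poly_hom f p = (\<Sum>m\<in>A. const (Poly_Mapping.lookup p m) *
           (\<Prod>x\<in>Poly_Mapping.keys m. f x ^ Poly_Mapping.lookup m x))"
  unfolding poly_hom_def
  by (rule sum.mono_neutral_left[OF assms])
     (auto simp: not_in_keys_iff_lookup_eq_zero const_def in_keys_iff)

lemma poly_hom_add: "poly_hom f (p + q) = poly_hom f p + poly_hom f q"
proof -
  let ?A = "Poly_Mapping.keys p \<union> Poly_Mapping.keys q"
  have "Poly_Mapping.keys (p + q) \<subseteq> ?A" by (rule Poly_Mapping.keys_add)
  then show ?thesis
    by (simp add: poly_hom_superset[of ?A] lookup_add const_add distrib_right sum.distrib)
qed

lemma poly_hom_zero [simp]: "poly_hom f 0 = 0"
  by (simp add: poly_hom_def)

lemma poly_hom_sum: "poly_hom f (sum g A) = (\<Sum>a\<in>A. poly_hom f (g a))"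
  by (induction A rule: infinite_finite_induct) (simp_all add: poly_hom_add)

lemma poly_hom_single:
  "poly_hom f (Poly_Mapping.single m c) =
     const c * (\<Prod>x\<in>Poly_Mapping.keys m. f x ^ Poly_Mapping.lookup m x)"
  by (simp add: poly_hom_def const_def)

lemma poly_hom_const: "poly_hom f (const c) = const c"
  unfolding const_def by (simp add: poly_hom_single const_def)

lemma poly_hom_var: "poly_hom f (var x) = f x"
  unfolding var_def by (simp add: poly_hom_single const_def)

lemma monom_eval_superset:
  fixes f :: "'x \<Rightarrow> ('y, 'k::field) mpoly"
  assumes "finite A" "Poly_Mapping.keys m \<subseteq> A"
  shows "(\<Prod>x\<in>Poly_Mapping.keys m. f x ^ Poly_Mapping.lookup m x) =
         (\<Prod>x\<in>A. f x ^ Poly_Mapping.lookup m x)"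
  by (rule prod.mono_neutral_left[OF assms]) (auto simp: in_keys_iff)

lemma monom_eval_add:
  fixes f :: "'x \<Rightarrow> ('y, 'k::field) mpoly" and m n :: "'x \<Rightarrow>\<^sub>0 nat"
  shows "(\<Prod>x\<in>Poly_Mapping.keys (m + n). f x ^ Poly_Mapping.lookup (m + n) x) =
         (\<Prod>x\<in>Poly_Mapping.keys m. f x ^ Poly_Mapping.lookup m x) *
         (\<Prod>x\<in>Poly_Mapping.keys n. f x ^ Poly_Mapping.lookup n x)"
proof -
  let ?A = "Poly_Mapping.keys m \<union> Poly_Mapping.keys n"
  have "Poly_Mapping.keys (m + n) \<subseteq> ?A" by (rule Poly_Mapping.keys_add)
  then have "(\<Prod>x\<in>Poly_Mapping.keys (m + n). f x ^ Poly_Mapping.lookup (m + n) x) =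
      (\<Prod>x\<in>?A. f x ^ Poly_Mapping.lookup (m + n) x)"
    by (intro monom_eval_superset) simp_all
  also have "\<dots> = (\<Prod>x\<in>?A. f x ^ Poly_Mapping.lookup m x) * (\<Prod>x\<in>?A. f x ^ Poly_Mapping.lookup n x)"
    by (simp add: lookup_add power_add prod.distrib)
  also have "\<dots> = (\<Prod>x\<in>Poly_Mapping.keys m. f x ^ Poly_Mapping.lookup m x) *
      (\<Prod>x\<in>Poly_Mapping.keys n. f x ^ Poly_Mapping.lookup n x)"
    by (simp add: monom_eval_superset[of ?A m] monom_eval_superset[of ?A n])
  finally show ?thesis .
qed

lemma poly_hom_mult: "poly_hom f (p * q) = poly_hom f p * poly_hom f q"
proof -
  let ?s = "\<lambda>p m. Poly_Mapping.single m (Poly_Mapping.lookup p m)"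
  have "p * q = (\<Sum>m\<in>Poly_Mapping.keys p. \<Sum>n\<in>Poly_Mapping.keys q. ?s p m * ?s q n)"
    by (subst (1) mpoly_expand[of p], subst (1) mpoly_expand[of q]) (rule sum_product)
  then have "poly_hom f (p * q) =
      (\<Sum>m\<in>Poly_Mapping.keys p. \<Sum>n\<in>Poly_Mapping.keys q. poly_hom f (?s p m * ?s q n))"
    by (simp add: poly_hom_sum)
  also have "\<dots> = (\<Sum>m\<in>Poly_Mapping.keys p. \<Sum>n\<in>Poly_Mapping.keys q.
      poly_hom f (?s p m) * poly_hom f (?s q n))"
    by (intro sum.cong refl)
       (simp add: mult_single poly_hom_single monom_eval_add const_mult algebra_simps)
  also have "\<dots> = poly_hom f (\<Sum>m\<in>Poly_Mapping.keys p. ?s p m) *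
      poly_hom f (\<Sum>n\<in>Poly_Mapping.keys q. ?s q n)"
    by (simp only: poly_hom_sum sum_product)
  also have "\<dots> = poly_hom f p * poly_hom f q"
    by (simp only: mpoly_expand[symmetric])
  finally show ?thesis .
qed

lemma const_in_poly_ring: "const c \<in> carrier (poly_ring X)"
  by (auto simp: poly_ring_def const_def)

lemma cring_poly_ring: "cring (poly_ring X :: ('x, 'k::field) mpoly ring)"
proof (rule cringI)
  show "abelian_group (poly_ring X :: ('x, 'k) mpoly ring)"
  proof (rule abelian_groupI)
    fix p :: "('x, 'k) mpoly" assume p: "p \<in> carrier (poly_ring X)"
    then have "- p \<in> carrier (poly_ring X)" by (simp add: poly_ring_def)
    then show "\<exists>q\<in>carrier (poly_ring X). q \<oplus>\<^bsub>poly_ring X\<^esub> p = \<zero>\<^bsub>poly_ring X\<^esub>"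
      by (intro bexI[of _ "- p"]) (simp_all add: poly_ring_def)
  next
    fix p q :: "('x, 'k) mpoly"
    assume "p \<in> carrier (poly_ring X)" "q \<in> carrier (poly_ring X)"
    then show "p \<oplus>\<^bsub>poly_ring X\<^esub> q \<in> carrier (poly_ring X)"
      using Poly_Mapping.keys_add[of p q] by (fastforce simp: poly_ring_def)
  qed (simp_all add: poly_ring_def add_ac)
  show "comm_monoid (poly_ring X :: ('x, 'k) mpoly ring)"
  proof (rule comm_monoidI)
    fix p q :: "('x, 'k) mpoly"
    assume pq: "p \<in> carrier (poly_ring X)" "q \<in> carrier (poly_ring X)"
    have "Poly_Mapping.keys r \<subseteq> X" if r: "r \<in> Poly_Mapping.keys (p * q)" for r
    proof -
      obtain m n where "r = m + n" "m \<in> Poly_Mapping.keys p" "n \<in> Poly_Mapping.keys q"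
        using r keys_mult[of p q] by blast
      then show ?thesis
        using pq Poly_Mapping.keys_add[of m n] by (fastforce simp: poly_ring_def)
    qed
    then show "p \<otimes>\<^bsub>poly_ring X\<^esub> q \<in> carrier (poly_ring X)"
      by (simp add: poly_ring_def)
  qed (simp_all add: poly_ring_def mult_ac)
qed (simp add: poly_ring_def algebra_simps)

lemma poly_hom_ring_hom:
  assumes "\<And>x. x \<in> X \<Longrightarrow> f x \<in> carrier (poly_ring Y :: ('y, 'k::field) mpoly ring)"
  shows "ring_hom_cring (poly_ring X) (poly_ring Y) (poly_hom f)"
proof -
  let ?Y = "poly_ring Y :: ('y, 'k) mpoly ring"
  interpret Y: cring ?Y by (rule cring_poly_ring)
  have mult: "a * b \<in> carrier ?Y" if "a \<in> carrier ?Y" "b \<in> carrier ?Y" for a b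
    using Y.m_closed[OF that] by (simp add: poly_ring_def)
  have one: "1 \<in> carrier ?Y" using Y.one_closed by (simp add: poly_ring_def)
  have pow: "a ^ k \<in> carrier ?Y" if "a \<in> carrier ?Y" for a k
    by (induction k) (use that one mult in auto)
  have prods: "prod g A \<in> carrier ?Y" if "\<And>a. a \<in> A \<Longrightarrow> g a \<in> carrier ?Y" for g and A :: "'x set"
    using that by (induction A rule: infinite_finite_induct) (use one mult in auto)
  have sums: "sum g A \<in> carrier ?Y" if "\<And>a. a \<in> A \<Longrightarrow> g a \<in> carrier ?Y"
    for g and A :: "('x \<Rightarrow>\<^sub>0 nat) set"
    using that
  proof (induction A rule: infinite_finite_induct)
    case (insert a A)
    then have "g a \<oplus>\<^bsub>?Y\<^esub> sum g A \<in> carrier ?Y" by (intro Y.a_closed) auto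
    with insert show ?case by (simp add: poly_ring_def)
  qed (simp_all add: poly_ring_def)
  have closed: "poly_hom f p \<in> carrier ?Y" if "p \<in> carrier (poly_ring X)" for p
    unfolding poly_hom_def
    by (intro sums mult prods pow const_in_poly_ring assms) (use that in \<open>auto simp: poly_ring_def\<close>)
  have "poly_hom f \<in> ring_hom (poly_ring X) ?Y"
    by (rule ring_hom_memI)
       (use closed poly_hom_const[of f 1] in
        \<open>auto simp: poly_hom_mult poly_hom_add const_def, simp_all add: poly_ring_def
           poly_hom_mult poly_hom_add\<close>)
  then show ?thesis
    by (intro ring_hom_cring.intro ring_hom_cring_axioms.intro cring_poly_ring)
qed

definition monom_degree :: "('x \<Rightarrow>\<^sub>0 nat) \<Rightarrow> nat" where
  "monom_degree m = (\<Sum>x\<in>Poly_Mapping.keys m. Poly_Mapping.lookup m x)"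

definition homogeneous_part :: "'x set \<Rightarrow> nat \<Rightarrow> ('x, 'k::field) mpoly set" where
  "homogeneous_part X d = {p \<in> carrier (poly_ring X). \<forall>m\<in>Poly_Mapping.keys p. monom_degree m = d}"


section \<open>Dimension and degree\<close>

text \<open>Krull dimension: the supremum of the lengths of chains of prime ideals.\<close>

definition krull_dim :: "('r, 's) ring_scheme \<Rightarrow> enat" where
  "krull_dim A = Sup {enat n |n. \<exists>P :: nat \<Rightarrow> 'r set.
     (\<forall>i\<le>n. primeideal (P i) A) \<and> (\<forall>i<n. P i \<subset> P (Suc i))}"

text \<open>The dimension of \<open>[R/I]\<^sub>d\<close> over \<open>\<bbbK>\<close>, for \<open>R = \<bbbK>[x : x \<in> X]\<close>. Both the degree \<open>d\<close> part of
  \<open>R/I\<close> and the copy of \<open>\<bbbK>\<close> acting on it are images of subsets of \<open>R\<close> under \<open>R \<rightarrow> R/I\<close>.\<close>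

definition hilbert_function :: "'x set \<Rightarrow> ('x, 'k::field) mpoly set \<Rightarrow> nat \<Rightarrow> nat" where
  "hilbert_function X I d =
     ring.dim (poly_ring X Quot I)
       ((\<lambda>p. I +>\<^bsub>poly_ring X\<^esub> p) ` range const)
       ((\<lambda>p. I +>\<^bsub>poly_ring X\<^esub> p) ` homogeneous_part X d)"

definition hilbert_series :: "'x set \<Rightarrow> ('x, 'k::field) mpoly set \<Rightarrow> int fps" where
  "hilbert_series X I = Abs_fps (\<lambda>d. int (hilbert_function X I d))"

text \<open>The equation \<open>HS(t) = k(t) / (1 - t)\<^sup>d\<close> is written in \<open>\<int>[[t]]\<close>, where \<open>1 - t\<close> is a unit.
  The exponent is the Krull dimension of \<open>R/I\<close>, which is finite because \<open>R\<close> has finite Krull dimension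
  for finite \<open>X\<close>; \<open>k\<close> is determined by the equation.\<close>

definition ideal_degree :: "'x set \<Rightarrow> ('x, 'k::field) mpoly set \<Rightarrow> int" where
  "ideal_degree X I = (THE c. \<exists>k :: int poly.
     hilbert_series X I * (1 - fps_X) ^ the_enat (krull_dim (poly_ring X Quot I)) = fps_of_poly k
     \<and> poly k 1 > 0 \<and> c = poly k 1)"


section \<open>Binary hierarchical models\<close>

text \<open>The variable \<open>p\<^sub>S\<close> is indexed by \<open>S\<close>, the variable \<open>\<theta>\<^bsub>(H,F)\<^esub>\<close> by the pair \<open>(H, F)\<close>.\<close>

definition theta_index :: "'a set set \<Rightarrow> ('a set \<times> 'a set) set" where
  "theta_index \<Delta> = {(H, F). F \<in> facets \<Delta> \<and> H \<subseteq> F}"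

definition model_map ::
  "'a set set \<Rightarrow> ('a set, 'k::field) mpoly \<Rightarrow> ('a set \<times> 'a set, 'k) mpoly" where
  "model_map \<Delta> = poly_hom (\<lambda>S. \<Prod>F\<in>facets \<Delta>. var (S \<inter> F, F))"

definition toric_ideal :: "'a set \<Rightarrow> 'a set set \<Rightarrow> ('a set, 'k::field) mpoly set" where
  "toric_ideal V \<Delta> = a_kernel (poly_ring (Pow V)) (poly_ring (theta_index \<Delta>)) (model_map \<Delta>)"

lemma ideal_toric_ideal:
  assumes "simplicial_complex V \<Delta>"
  shows "ideal (toric_ideal V \<Delta> :: ('a set, 'k::field) mpoly set) (poly_ring (Pow V))"
proof -
  let ?T = "poly_ring (theta_index \<Delta>) :: ('a set \<times> 'a set, 'k) mpoly ring"
  interpret T: cring ?T by (rule cring_poly_ring)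
  have "(\<Prod>F\<in>B. var (S \<inter> F, F)) \<in> carrier ?T" if "B \<subseteq> facets \<Delta>" for B S
    using that
  proof (induction B rule: infinite_finite_induct)
    case (insert F B)
    then have "var (S \<inter> F, F) \<in> carrier ?T"
      by (auto simp: poly_ring_def var_def theta_index_def)
    with insert have "var (S \<inter> F, F) \<otimes>\<^bsub>?T\<^esub> (\<Prod>F\<in>B. var (S \<inter> F, F)) \<in> carrier ?T"
      by (intro T.m_closed) auto
    with insert show ?case by (simp add: poly_ring_def)
  qed (simp_all add: poly_ring_def)
  then have "ring_hom_cring (poly_ring (Pow V)) ?T (model_map \<Delta>)"
    unfolding model_map_def by (intro poly_hom_ring_hom) auto
  then interpret ring_hom_cring "poly_ring (Pow V)" ?T "model_map \<Delta>" .
  have "ring_hom_ring (poly_ring (Pow V)) ?T (model_map \<Delta>)"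
    by (rule ring_hom_ringI2[OF R.ring_axioms T.ring_axioms homh])
  then show ?thesis
    unfolding toric_ideal_def by (rule ring_hom_ring.kernel_is_ideal)
qed

end

theory Submission
  imports Defs
begin

text \<open>Setting \<open>R = \<bbbK>[p\<^sub>S : S \<subseteq> V]\<close>, the ring \<open>R / I(\<Delta>)\<close> is spanned by the monomials in the
  parameters \<open>\<theta>\<close> that are products of images of the variables \<open>p\<^sub>S\<close>, and its Hilbert function counts these
  monomials by degree (\<open>hilbert_function_toric_kernel\<close>). In the cone, the parameters \<open>\<theta>\<close> split into two
  disjoint copies of those of \<open>\<Delta>\<close>: one is used by the variables \<open>p\<^sub>S\<close> with \<open>S\<close> avoiding the apex, the other
  by those with \<open>S\<close> containing it (\<open>model_expo_cone\<close>). A monomial of the cone is thus a pair of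
  monomials of \<open>\<Delta>\<close>, and the Hilbert series of the cone is the square of that of \<open>\<Delta>\<close>
  (\<open>hilbert_series_cone\<close>).

  To conclude for degrees, one needs that \<open>k(t) / (1 - t)\<^sup>d\<close> with \<open>d\<close> the Krull dimension is the reduced
  form of the Hilbert series, that is, \<open>k(1) > 0\<close>. This is \<open>hilbert_series_toric_kernel\<close>, proved for every
  homogeneous toric ring. Once it is applied to \<open>\<Delta>\<close> and to its cone, the pole orders and numerators of a
  series and its square can be compared (\<open>rational_square_value\<close>).

  The proof that the Krull dimension is the order \<open>e\<close> of the pole at \<open>1\<close> has three parts. Standard monomials
  and Dickson's lemma show that the Hilbert series is rational (\<open>card_image_monoms_rational\<close>), so that
  the number of monomials of degree at most \<open>d\<close> grows exactly like \<open>d\<^sup>e\<close>. Setting the parameters to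
  \<open>1\<close> one at a time gives a chain of toric prime ideals, and a step that does not enlarge the ideal
  identifies no monomials, while any other step reduces their number at most by a factor linear in \<open>d\<close>, so
  there are at least \<open>e\<close> strict inclusions (\<open>toric_prime_chain\<close>). Conversely,
  a chain of \<open>n\<close> strict inclusions of primes provides \<open>n\<close> algebraically independent elements, and their
  monomials are too numerous if \<open>n > e\<close> (\<open>toric_prime_chain_length_le\<close>).\<close>

section \<open>Monomial substitutions and their kernels\<close>

abbreviation (input) "lookup \<equiv> Poly_Mapping.lookup"
abbreviation (input) "keys \<equiv> Poly_Mapping.keys"
abbreviation (input) "single \<equiv> Poly_Mapping.single"

text \<open>The exponent vector of the image of the monomial \<open>x\<^sup>m\<close> under the substitution sending each
  variable \<open>x\<close> to the monomial with exponent vector \<open>a x\<close>. The inner sum is the multiple of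
  \<open>a x\<close> by the exponent of \<open>x\<close>.\<close>

definition expo :: "('x \<Rightarrow> ('y \<Rightarrow>\<^sub>0 nat)) \<Rightarrow> ('x \<Rightarrow>\<^sub>0 nat) \<Rightarrow> ('y \<Rightarrow>\<^sub>0 nat)" where
  "expo a m = (\<Sum>x\<in>keys m. \<Sum>i<lookup m x. a x)"

lemma lookup_expo_superset:
  assumes "finite A" "keys m \<subseteq> A"
  shows "lookup (expo a m) y = (\<Sum>x\<in>A. lookup m x * lookup (a x) y)"
proof -
  have "lookup (expo a m) y = (\<Sum>x\<in>keys m. lookup m x * lookup (a x) y)"
    by (simp add: expo_def lookup_sum)
  also have "\<dots> = (\<Sum>x\<in>A. lookup m x * lookup (a x) y)"
    by (rule sum.mono_neutral_left) (use assms in \<open>auto simp: in_keys_iff\<close>)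
  finally show ?thesis .
qed

lemmas lookup_expo = lookup_expo_superset[OF finite_keys order_refl]

lemma expo_zero [simp]: "expo a 0 = 0"
  by (simp add: expo_def)

lemma expo_single_one [simp]: "expo a (single x (Suc 0)) = a x"
  by (simp add: expo_def)

lemma expo_add: "expo a (m + n) = expo a m + expo a n"
proof (rule poly_mapping_eqI)
  fix y
  have "finite (keys m \<union> keys n)" "keys (m + n) \<subseteq> keys m \<union> keys n"
    by (simp_all add: Poly_Mapping.keys_add)
  then show "lookup (expo a (m + n)) y = lookup (expo a m + expo a n) y"
    by (simp add: lookup_expo_superset[of "keys m \<union> keys n"] lookup_add distrib_right sum.distrib)
qed

definition monomial_map :: "('x \<Rightarrow> ('y \<Rightarrow>\<^sub>0 nat)) \<Rightarrow> ('x, 'k::field) mpoly \<Rightarrow> ('y, 'k) mpoly" where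
  "monomial_map a = poly_hom (\<lambda>x. single (a x) 1)"

lemma single_power: "single u (1::'k::field) ^ n = single (\<Sum>i<n. u :: 'y \<Rightarrow>\<^sub>0 nat) 1"
  by (induction n) (simp_all add: mult_single add.commute)

lemma prod_single: "(\<Prod>x\<in>A. single (u x) (1::'k::field)) = single (\<Sum>x\<in>A. u x :: 'y \<Rightarrow>\<^sub>0 nat) 1"
  by (induction A rule: infinite_finite_induct) (simp_all add: mult_single)

lemma monomial_map_single: "monomial_map a (single m c) = single (expo a m) c"
  by (simp add: monomial_map_def poly_hom_single single_power prod_single expo_def const_def mult_single)

lemma monomial_map_eq_sum:
  "monomial_map a p = (\<Sum>m\<in>keys p. single (expo a m) (lookup p m))"
proof -
  have "monomial_map a p = monomial_map a (\<Sum>m\<in>keys p. single m (lookup p m))"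
    by (simp flip: mpoly_expand)
  also have "\<dots> = (\<Sum>m\<in>keys p. monomial_map a (single m (lookup p m)))"
    by (simp add: monomial_map_def poly_hom_sum)
  finally show ?thesis by (simp add: monomial_map_single)
qed

text \<open>Monomials with the same image are merged, so a polynomial lies in the kernel exactly when its
  coefficients add up to zero over every fibre of \<open>expo a\<close>. Kernels are therefore determined by
  the fibres alone.\<close>

lemma lookup_monomial_map:
  "lookup (monomial_map a p) t = (\<Sum>m\<in>{m \<in> keys p. expo a m = t}. lookup p m)"
  by (simp add: monomial_map_eq_sum lookup_sum lookup_single when_def sum.inter_filter)

lemma monomial_map_add: "monomial_map a (p + q) = monomial_map a p + monomial_map a q"
  by (simp add: monomial_map_def poly_hom_add)

lemma monomial_map_mult: "monomial_map a (p * q) = monomial_map a p * monomial_map a q"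
  by (simp add: monomial_map_def poly_hom_mult)

lemma monomial_map_zero [simp]: "monomial_map a 0 = 0"
  by (simp add: monomial_map_def)

lemma monomial_map_uminus: "monomial_map a (- p) = - monomial_map a p"
  using monomial_map_add[of a p "- p"] by (simp add: eq_neg_iff_add_eq_0 add.commute)

lemma monomial_map_diff: "monomial_map a (p - q) = monomial_map a p - monomial_map a q"
  using monomial_map_add[of a p "- q"] by (simp add: monomial_map_uminus)

lemma monomial_map_const [simp]: "monomial_map a (const c) = const c"
  by (simp add: monomial_map_def poly_hom_const)

lemma monomial_map_sum: "monomial_map a (sum g A) = (\<Sum>i\<in>A. monomial_map a (g i))"
  by (simp add: monomial_map_def poly_hom_sum)

definition toric_kernel :: "'x set \<Rightarrow> ('x \<Rightarrow> ('y \<Rightarrow>\<^sub>0 nat)) \<Rightarrow> ('x, 'k::field) mpoly set" where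
  "toric_kernel X a = {p \<in> carrier (poly_ring X). monomial_map a p = 0}"

text \<open>A coarser map on exponent vectors has larger fibres, and a fibre sum for \<open>b\<close> is a sum of fibre
  sums for \<open>a\<close>.\<close>

lemma toric_kernel_mono:
  assumes "\<And>m m'. keys m \<subseteq> X \<Longrightarrow> keys m' \<subseteq> X \<Longrightarrow> expo a m = expo a m' \<Longrightarrow> expo b m = expo b m'"
  shows "(toric_kernel X a :: ('x, 'k::field) mpoly set) \<subseteq> toric_kernel X b"
proof
  fix p :: "('x, 'k) mpoly" assume "p \<in> toric_kernel X a"
  then have p: "p \<in> carrier (poly_ring X)" "monomial_map a p = 0"
    by (auto simp: toric_kernel_def)
  have "lookup (monomial_map b p) t = 0" for t
  proof -
    let ?S = "{m \<in> keys p. expo b m = t}"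
    have "(\<Sum>m\<in>?S. lookup p m) = (\<Sum>s\<in>expo a ` ?S. \<Sum>m\<in>{m \<in> ?S. expo a m = s}. lookup p m)"
      by (rule sum.image_gen) simp
    also have "\<dots> = (\<Sum>s\<in>expo a ` ?S. 0)"
    proof (rule sum.cong[OF refl])
      fix s assume "s \<in> expo a ` ?S"
      then obtain m where m: "m \<in> keys p" "expo b m = t" "expo a m = s" by auto
      have "expo b m' = t" if "m' \<in> keys p" "expo a m' = s" for m'
        using assms[of m' m] m that p(1) by (auto simp: poly_ring_def)
      then have "{m \<in> ?S. expo a m = s} = {m \<in> keys p. expo a m = s}" by auto
      then show "(\<Sum>m\<in>{m \<in> ?S. expo a m = s}. lookup p m) = 0"
        using lookup_monomial_map[of a p s] p(2) by simp
    qed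
    finally show ?thesis by (simp add: lookup_monomial_map)
  qed
  then show "p \<in> toric_kernel X b"
    using p by (auto simp: toric_kernel_def intro: poly_mapping_eqI)
qed

text \<open>Renaming the variables of a monomial by \<open>g\<close>. Besides the injections used for cones, renaming into
  the natural numbers is used to borrow the lexicographic order on \<open>nat \<Rightarrow>\<^sub>0 nat\<close> for exponent vectors
  over an index type without an order.\<close>

abbreviation relabel :: "('y \<Rightarrow> 'z) \<Rightarrow> ('y \<Rightarrow>\<^sub>0 nat) \<Rightarrow> ('z \<Rightarrow>\<^sub>0 nat)" where
  "relabel g \<equiv> expo (\<lambda>y. single (g y) (Suc 0))"

lemma lookup_relabel:
  assumes "inj_on g Y" "finite Y" "keys m \<subseteq> Y" "y \<in> Y"
  shows "lookup (relabel g m) (g y) = lookup m y"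
proof -
  have "lookup (relabel g m) (g y) = (\<Sum>x\<in>Y. if x = y then lookup m x else 0)"
    unfolding lookup_expo_superset[OF assms(2,3)]
    by (rule sum.cong) (use assms in \<open>auto simp: lookup_single when_def inj_on_eq_iff\<close>)
  then show ?thesis using assms by simp
qed

lemma inj_on_relabel:
  assumes "inj_on g Y" "finite Y"
  shows "inj_on (relabel g) {m. keys m \<subseteq> Y}"
proof (rule inj_onI, rule poly_mapping_eqI)
  fix m m' y assume *: "m \<in> {m. keys m \<subseteq> Y}" "m' \<in> {m. keys m \<subseteq> Y}" "relabel g m = relabel g m'"
  show "lookup m y = lookup m' y"
  proof (cases "y \<in> Y")
    case True
    then show ?thesis using * lookup_relabel[OF assms] by (metis mem_Collect_eq)
  next
    case False
    then show ?thesis using * by (metis in_keys_iff mem_Collect_eq subsetD)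
  qed
qed

text \<open>Only finitely many variables occur in \<open>p\<close> and \<open>q\<close>, so they can be renamed to natural numbers
  without identifying monomials. Over a linearly ordered set of variables the product of the leading
  monomials survives.\<close>

lemma mpoly_no_zero_divisors:
  fixes p q :: "('y, 'k::field) mpoly"
  assumes "p * q = 0"
  shows "p = 0 \<or> q = 0"
proof -
  define Y where "Y = (\<Union>m\<in>keys p \<union> keys q. keys m)"
  have fin: "finite Y" by (simp add: Y_def)
  then obtain g :: "'y \<Rightarrow> nat" where g: "inj_on g Y"
    using finite_imp_inj_to_nat_seg by blast
  let ?f = "monomial_map (\<lambda>y. single (g y) (Suc 0)) :: ('y, 'k) mpoly \<Rightarrow> (nat, 'k) mpoly"
  have inj: "r = 0" if "?f r = 0" "\<And>m. m \<in> keys r \<Longrightarrow> keys m \<subseteq> Y" for r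
  proof (rule poly_mapping_eqI)
    fix m
    show "lookup r m = lookup 0 m"
    proof (cases "m \<in> keys r")
      case True
      then have "{m' \<in> keys r. relabel g m' = relabel g m} = {m}"
        using inj_on_relabel[OF g fin] that(2) by (auto simp: inj_on_def)
      then show ?thesis
        using lookup_monomial_map[of "\<lambda>y. single (g y) (Suc 0)" r "relabel g m"] that(1) by simp
    qed (simp add: in_keys_iff)
  qed
  have "?f p * ?f q = 0" using assms by (simp flip: monomial_map_mult)
  then have "?f p = 0 \<or> ?f q = 0" by simp
  then show ?thesis using inj by (auto simp: Y_def)
qed

lemma keys_add_nat: "keys (m + n :: 'x \<Rightarrow>\<^sub>0 nat) = keys m \<union> keys n"
  by (auto simp: in_keys_iff lookup_add)

lemma monom_degree_superset:
  assumes "finite A" "keys m \<subseteq> A"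
  shows "monom_degree m = (\<Sum>x\<in>A. lookup m x)"
  unfolding monom_degree_def
  by (rule sum.mono_neutral_left) (use assms in \<open>auto simp: in_keys_iff\<close>)

lemma monom_degree_add: "monom_degree (m + n) = monom_degree m + monom_degree n"
  by (simp add: monom_degree_superset[of "keys m \<union> keys n"] keys_add_nat lookup_add sum.distrib)

lemma monom_degree_zero [simp]: "monom_degree 0 = 0"
  by (simp add: monom_degree_def)

lemma monom_degree_eq_0_iff: "monom_degree m = 0 \<longleftrightarrow> m = 0"
  by (auto simp: monom_degree_def in_keys_iff intro: poly_mapping_eqI)

lemma monom_degree_single [simp]: "monom_degree (single x n) = n"
  by (simp add: monom_degree_def)

lemma monom_degree_sum: "monom_degree (\<Sum>i\<in>I. u i) = (\<Sum>i\<in>I. monom_degree (u i))"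
  by (induction I rule: infinite_finite_induct) (simp_all add: monom_degree_add)

lemma monom_degree_expo:
  assumes "\<And>x. x \<in> X \<Longrightarrow> monom_degree (a x) = w" "keys m \<subseteq> X"
  shows "monom_degree (expo a m) = monom_degree m * w"
proof -
  have "monom_degree (expo a m) = (\<Sum>x\<in>keys m. lookup m x * monom_degree (a x))"
    by (simp add: expo_def monom_degree_sum)
  also have "\<dots> = (\<Sum>x\<in>keys m. lookup m x * w)"
    by (rule sum.cong) (use assms in auto)
  finally show ?thesis by (simp add: monom_degree_def sum_distrib_right)
qed

definition monoms :: "'x set \<Rightarrow> nat \<Rightarrow> ('x \<Rightarrow>\<^sub>0 nat) set" where
  "monoms X d = {m. keys m \<subseteq> X \<and> monom_degree m = d}"

definition monoms_upto :: "'x set \<Rightarrow> nat \<Rightarrow> ('x \<Rightarrow>\<^sub>0 nat) set" where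
  "monoms_upto X d = {m. keys m \<subseteq> X \<and> monom_degree m \<le> d}"

lemma lookup_le_monom_degree: "lookup m x \<le> monom_degree m"
proof (cases "x \<in> keys m")
  case True
  then show ?thesis unfolding monom_degree_def by (intro member_le_sum) auto
qed (simp add: in_keys_iff)

lemma finite_monoms_upto: 
  assumes "finite X" shows "finite (monoms_upto X d)"
proof -
  have "finite {f. \<forall>x. (x \<in> X \<longrightarrow> f x \<in> {..d}) \<and> (x \<notin> X \<longrightarrow> f x = 0)}"
    using assms by (intro finite_set_of_finite_funs) auto
  moreover have "lookup ` monoms_upto X d \<subseteq> {f. \<forall>x. (x \<in> X \<longrightarrow> f x \<in> {..d}) \<and> (x \<notin> X \<longrightarrow> f x = 0)}"
    by (auto simp: monoms_upto_def in_keys_iff intro: order_trans[OF lookup_le_monom_degree])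
  ultimately have "finite (lookup ` monoms_upto X d)" by (rule finite_subset[rotated])
  then show ?thesis
    by (rule finite_imageD) (auto intro: inj_onI poly_mapping_eqI)
qed

lemma finite_monoms:
  assumes "finite X" shows "finite (monoms X d)"
  by (rule finite_subset[OF _ finite_monoms_upto[OF assms, of d]])
     (auto simp: monoms_def monoms_upto_def)

section \<open>Rationality of Hilbert series: standard monomials and Dickson's lemma\<close>

text \<open>A decreasing sequence of natural numbers is eventually constant, so of the two kinds of monotone
  subsequence only the increasing ones matter.\<close>

lemma ex_mono_subseq_nat:
  fixes f :: "nat \<Rightarrow> nat"
  shows "\<exists>\<phi> :: nat \<Rightarrow> nat. strict_mono \<phi> \<and> mono (f \<circ> \<phi>)"
proof -
  obtain r :: "nat \<Rightarrow> nat" where r: "strict_mono r" "monoseq (\<lambda>i. f (r i))"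
    using seq_monosub[of f] by auto
  show ?thesis
  proof (cases "incseq (\<lambda>i. f (r i))")
    case True
    then show ?thesis using r(1) by (auto simp: comp_def)
  next
    case False
    then have dec: "decseq (\<lambda>i. f (r i))" using r(2) by (simp add: monoseq_iff)
    obtain k where k: "\<And>i. f (r k) \<le> f (r i)"
      using ex_has_least_nat[of "\<lambda>_. True" 0 "\<lambda>i. f (r i)"] by auto
    have const: "f (r (i + k)) = f (r k)" for i
      using decseqD[OF dec, of k "i + k"] k[of "i + k"] by simp
    have "strict_mono (\<lambda>i. r (i + k))" using r(1) by (simp add: strict_mono_def)
    moreover have "mono (f \<circ> (\<lambda>i. r (i + k)))" by (simp add: mono_def const)
    ultimately show ?thesis by blast
  qed
qed

text \<open>Dickson's lemma in the form of a subsequence that increases in each coordinate: pass to a monotone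
  subsequence for one coordinate after the other.\<close>

lemma dickson_subseq:
  fixes m :: "nat \<Rightarrow> ('x \<Rightarrow>\<^sub>0 nat)"
  assumes "finite X"
  shows "\<exists>\<phi> :: nat \<Rightarrow> nat. strict_mono \<phi> \<and> (\<forall>x\<in>X. mono (\<lambda>i. lookup (m (\<phi> i)) x))"
  using assms
proof (induction X)
  case empty
  show ?case by (rule exI[of _ id]) (simp add: strict_mono_def)
next
  case (insert x X)
  then obtain \<phi> :: "nat \<Rightarrow> nat" where \<phi>: "strict_mono \<phi>" "\<And>x. x \<in> X \<Longrightarrow> mono (\<lambda>i. lookup (m (\<phi> i)) x)" by blast
  obtain \<psi> :: "nat \<Rightarrow> nat" where \<psi>: "strict_mono \<psi>" "mono ((\<lambda>i. lookup (m (\<phi> i)) x) \<circ> \<psi>)"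
    using ex_mono_subseq_nat by blast
  have "strict_mono (\<phi> \<circ> \<psi>)" using \<phi>(1) \<psi>(1) by (simp add: strict_mono_o)
  moreover have "mono (\<lambda>i. lookup (m ((\<phi> \<circ> \<psi>) i)) y)" if "y \<in> insert x X" for y
  proof (cases "y = x")
    case True then show ?thesis using \<psi>(2) by (simp add: comp_def)
  next
    case False
    then show ?thesis using \<phi>(2)[of y] that \<psi>(1)
      by (auto simp: mono_def strict_mono_less_eq)
  qed
  ultimately show ?case by blast
qed

text \<open>The exponent vectors of the monomials outside a monomial ideal: a set closed under passing to
  divisors.\<close>

definition order_ideal :: "'x set \<Rightarrow> ('x \<Rightarrow>\<^sub>0 nat) set \<Rightarrow> bool" where
  "order_ideal X B \<longleftrightarrow> (\<forall>m\<in>B. keys m \<subseteq> X) \<and> (\<forall>m n. m + n \<in> B \<longrightarrow> m \<in> B)"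

definition gen_fun :: "('x \<Rightarrow>\<^sub>0 nat) set \<Rightarrow> int fps" where
  "gen_fun B = Abs_fps (\<lambda>d. int (card {m \<in> B. monom_degree m = d}))"

lemma add_diff_of_le:
  fixes m m' :: "'x \<Rightarrow>\<^sub>0 nat"
  assumes "\<And>x. lookup m x \<le> lookup m' x"
  shows "m + (m' - m) = m'"
  using assms by (intro poly_mapping_eqI) (simp add: lookup_add lookup_minus)

text \<open>This is the Noetherian property of monomial ideals. If the chain never stabilised, choose \<open>m s\<close> lost at
  step \<open>s\<close>; Dickson's lemma gives \<open>i < j\<close> with \<open>m i\<close> dividing \<open>m j\<close>, and \<open>m j\<close> is still present after
  step \<open>i\<close>, which keeps \<open>m i\<close> as well.\<close>

lemma order_ideal_chain_stable:
  assumes "finite X" "\<And>i. order_ideal X (B i)" "\<And>i. B (Suc i) \<subseteq> B i"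
  shows "\<exists>s. B (Suc s) = B s"
proof (rule ccontr)
  assume "\<nexists>s. B (Suc s) = B s"
  then have "\<forall>s. \<exists>m. m \<in> B s \<and> m \<notin> B (Suc s)" using assms(3) by blast
  then obtain m where m: "\<And>s. m s \<in> B s" "\<And>s. m s \<notin> B (Suc s)" by metis
  obtain \<phi> :: "nat \<Rightarrow> nat" where \<phi>: "strict_mono \<phi>" "\<And>x. x \<in> X \<Longrightarrow> mono (\<lambda>i. lookup (m (\<phi> i)) x)"
    using dickson_subseq[OF assms(1), of m] by blast
  define i where "i = \<phi> 0"
  define j where "j = \<phi> 1"
  have "i < j" using \<phi>(1) by (simp add: i_def j_def strict_mono_def)
  have "lookup (m i) x \<le> lookup (m j) x" for x
  proof (cases "x \<in> X")
    case True
    then show ?thesis using monoD[OF \<phi>(2), of x 0 1] by (simp add: i_def j_def)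
  next
    case False
    then have "x \<notin> keys (m i)" using assms(2)[of i] m(1)[of i] by (auto simp: order_ideal_def)
    then show ?thesis by (simp add: in_keys_iff)
  qed
  then have *: "m i + (m j - m i) = m j" by (rule add_diff_of_le)
  have anti: "B j' \<subseteq> B i'" if "i' \<le> j'" for i' j'
    using lift_Suc_antimono_le[of B, OF assms(3) that] .
  have "m j \<in> B (Suc i)" using m(1)[of j] anti[of "Suc i" j] \<open>i < j\<close> by auto
  then have "m i \<in> B (Suc i)" using assms(2)[of "Suc i"] * unfolding order_ideal_def by metis
  then show False using m(2) by blast
qed

text \<open>The monomials of \<open>B\<close> without \<open>x\<close> are listed apart; dividing the others by \<open>x\<close> lowers the degree by
  one.\<close>

lemma gen_fun_split:
  assumes "finite X" "order_ideal X B"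
  shows "gen_fun B = gen_fun {m \<in> B. lookup m x = 0} + fps_X * gen_fun {m. m + single x 1 \<in> B}"
    (is "_ = gen_fun ?B0 + fps_X * gen_fun ?B1")
proof (rule fps_ext)
  fix d
  have fin: "finite {m \<in> B. monom_degree m = d \<and> P m}" for P d
    by (rule finite_subset[OF _ finite_monoms[OF assms(1), of d]])
       (use assms(2) in \<open>auto simp: order_ideal_def monoms_def\<close>)
  have union: "{m \<in> B. monom_degree m = d} = {m \<in> ?B0. monom_degree m = d} \<union>
      {m \<in> B. monom_degree m = d \<and> lookup m x > 0}" by auto
  have "card {m \<in> B. monom_degree m = d} = card {m \<in> ?B0. monom_degree m = d} +
      card {m \<in> B. monom_degree m = d \<and> lookup m x > 0}"
    unfolding union by (rule card_Un_disjoint)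
      (use fin[of d "\<lambda>m. lookup m x = 0"] fin[of d "\<lambda>m. lookup m x > 0"] in \<open>auto simp: conj_ac\<close>)
  moreover have "card {m \<in> B. monom_degree m = d \<and> lookup m x > 0} =
      (if d = 0 then 0 else card {m \<in> ?B1. monom_degree m = d - 1})"
  proof (cases d)
    case 0
    then have none: "{m \<in> B. monom_degree m = d \<and> lookup m x > 0} = {}"
      by (auto simp: monom_degree_eq_0_iff)
    show ?thesis unfolding none using 0 by simp
  next
    case (Suc e)
    have "bij_betw (\<lambda>m. m + single x 1) {m \<in> ?B1. monom_degree m = e}
        {m \<in> B. monom_degree m = d \<and> lookup m x > 0}"
    proof (rule bij_betwI[where g = "\<lambda>m. m - single x 1"])
      have "m - single x 1 + single x 1 = m" if "lookup m x > 0" for m :: "'a \<Rightarrow>\<^sub>0 nat"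
        using that by (intro poly_mapping_eqI) (auto simp: lookup_add lookup_minus lookup_single when_def)
      note inv = this
      show "(\<lambda>m. m - single x 1) \<in> {m \<in> B. monom_degree m = d \<and> 0 < lookup m x} \<rightarrow>
          {m \<in> ?B1. monom_degree m = e}"
      proof
        fix m assume "m \<in> {m \<in> B. monom_degree m = d \<and> 0 < lookup m x}"
        then have m: "m \<in> B" "monom_degree m = d" "0 < lookup m x" by auto
        have "monom_degree (m - single x 1) + 1 = monom_degree m"
          using inv[OF m(3)] monom_degree_add[of "m - single x 1" "single x 1"] by simp
        then show "m - single x 1 \<in> {m \<in> ?B1. monom_degree m = e}"
          using m Suc inv[OF m(3)] by simp
      qed
      fix m assume "m \<in> {m \<in> B. monom_degree m = d \<and> 0 < lookup m x}"
      then show "m - single x 1 + single x 1 = m" using inv by simp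
    qed (auto simp: Suc monom_degree_add lookup_add lookup_single)
    then show ?thesis using Suc by (simp add: bij_betw_same_card)
  qed
  ultimately show "fps_nth (gen_fun B) d = fps_nth (gen_fun ?B0 + fps_X * gen_fun ?B1) d"
    by (simp add: gen_fun_def)
qed

text \<open>Induction on the number of variables. Dividing by a variable \<open>x\<close> again and again gives a descending
  chain of order ideals \<open>S i\<close>, which becomes constant at some \<open>s\<close>. There the splitting equation reads
  \<open>(1 - t) * gen_fun (S s) = gen_fun (face)\<close> with a face in one variable less, and the equation
  carries rationality back from \<open>S (Suc i)\<close> to \<open>S i\<close>, down to \<open>S 0 = B\<close>.\<close>

lemma gen_fun_order_ideal_rational:
  assumes "finite X" "order_ideal X B"
  shows "\<exists>q. gen_fun B * (1 - fps_X) ^ card X = fps_of_poly q"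
  using assms
proof (induction X arbitrary: B)
  case empty
  have "gen_fun B = fps_of_poly [: int (card {m \<in> B. m = 0}) :]"
  proof (rule fps_ext)
    fix d
    have "{m \<in> B. monom_degree m = d} = (if d = 0 then {m \<in> B. m = 0} else {})"
      using empty by (auto simp: order_ideal_def)
    then show "fps_nth (gen_fun B) d = fps_nth (fps_of_poly [: int (card {m \<in> B. m = 0}) :]) d"
      by (simp add: gen_fun_def coeff_pCons split: nat.split)
  qed
  then show ?case by auto
next
  case (insert x X)
  let ?rat = "\<lambda>B. \<exists>q. gen_fun B * (1 - fps_X) ^ card (insert x X) = fps_of_poly q"
  define S where "S i = {m. m + single x i \<in> B}" for i
  have ideal: "order_ideal (insert x X) (S i)" for i
    unfolding order_ideal_def S_def
  proof (intro conjI ballI allI impI)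
    show "keys m \<subseteq> insert x X" if "m \<in> {m. m + single x i \<in> B}" for m
      using that insert.prems keys_add_nat[of m "single x i"] by (auto simp: order_ideal_def)
    show "m \<in> {m. m + single x i \<in> B}" if "m + n \<in> {m. m + single x i \<in> B}" for m n
    proof -
      have "(m + single x i) + n \<in> B" using that by (simp add: ac_simps)
      then show ?thesis using insert.prems unfolding order_ideal_def by blast
    qed
  qed
  have shift: "{m. m + single x 1 \<in> S i} = S (Suc i)" for i
    by (simp add: S_def add.assoc flip: single_add)
  have face: "\<exists>q. gen_fun {m \<in> S i. lookup m x = 0} * (1 - fps_X) ^ card X = fps_of_poly q" for i
  proof (rule insert.IH)
    show "order_ideal X {m \<in> S i. lookup m x = 0}"
      unfolding order_ideal_def
    proof (intro conjI ballI allI impI)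
      fix m assume m: "m \<in> {m \<in> S i. lookup m x = 0}"
      then have "keys m \<subseteq> insert x X" "x \<notin> keys m"
        using ideal[of i] by (auto simp: order_ideal_def in_keys_iff)
      then show "keys m \<subseteq> X" by blast
    next
      fix m n assume *: "m + n \<in> {m \<in> S i. lookup m x = 0}"
      then have "m \<in> S i" using ideal[of i] unfolding order_ideal_def by blast
      then show "m \<in> {m \<in> S i. lookup m x = 0}" using * by (simp add: lookup_add)
    qed
  qed
  have split: "gen_fun (S i) = gen_fun {m \<in> S i. lookup m x = 0} + fps_X * gen_fun (S (Suc i))" for i
    using gen_fun_split[OF _ ideal[of i], of x] insert.hyps by (simp only: shift finite_insert)
  have card: "card (insert x X) = Suc (card X)" using insert.hyps by simp
  have "S (Suc i) \<subseteq> S i" for i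
  proof
    fix m assume "m \<in> S (Suc i)"
    then have "(m + single x i) + single x 1 \<in> B"
      by (simp add: S_def add.assoc flip: single_add)
    then show "m \<in> S i" using insert.prems unfolding order_ideal_def S_def by blast
  qed
  then obtain s where s: "S (Suc s) = S s"
    using order_ideal_chain_stable[of "insert x X" S] ideal insert.hyps by auto
  have "?rat (S s)"
  proof -
    obtain q where q: "gen_fun {m \<in> S s. lookup m x = 0} * (1 - fps_X) ^ card X = fps_of_poly q"
      using face by blast
    have "gen_fun (S s) * (1 - fps_X) = gen_fun {m \<in> S s. lookup m x = 0}"
      using split[of s] s by (simp add: algebra_simps)
    then have "gen_fun (S s) * (1 - fps_X) ^ card (insert x X) = fps_of_poly q"
      using q by (simp add: card mult.assoc[symmetric])
    then show ?thesis by blast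
  qed
  moreover have "?rat (S i)" if rat: "?rat (S (Suc i))" for i
  proof -
    obtain q where q: "gen_fun {m \<in> S i. lookup m x = 0} * (1 - fps_X) ^ card X = fps_of_poly q"
      using face by blast
    obtain r where r: "gen_fun (S (Suc i)) * (1 - fps_X) ^ card (insert x X) = fps_of_poly r"
      using rat by blast
    have "gen_fun (S i) * (1 - fps_X) ^ card (insert x X) =
        (gen_fun {m \<in> S i. lookup m x = 0} * (1 - fps_X) ^ card X) * (1 - fps_X) +
        fps_X * (gen_fun (S (Suc i)) * (1 - fps_X) ^ card (insert x X))"
      by (subst split) (simp add: card algebra_simps)
    also have "\<dots> = fps_of_poly (q * [:1, -1:] + [:0, 1:] * r)"
      unfolding q r by (simp add: fps_of_poly_add fps_of_poly_mult fps_of_poly_pCons)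
    finally show ?thesis by blast
  qed
  ultimately have "?rat (S 0)" using inc_induct[of 0 s "\<lambda>i. ?rat (S i)"] by blast
  then show ?case by (simp add: S_def)
qed

text \<open>In each fibre of \<open>expo a\<close> select the least monomial for a monomial order. The order is compatible
  with multiplication, so a divisor of a selected (standard) monomial is again selected: the
  standard monomials form an order ideal, and they are in degree preserving bijection with the image.
  Homogeneity makes the fibres finite, so that a least element exists, and keeps them within one
  degree.\<close>

lemma card_image_monoms_rational:
  fixes a :: "'x \<Rightarrow> ('y \<Rightarrow>\<^sub>0 nat)"
  assumes "finite X" "\<And>x. x \<in> X \<Longrightarrow> monom_degree (a x) = w" "w > 0"
  shows "\<exists>q. Abs_fps (\<lambda>d. int (card (expo a ` monoms X d))) * (1 - fps_X) ^ card X = fps_of_poly q"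
proof -
  obtain g :: "'x \<Rightarrow> nat" where g: "inj_on g X"
    using finite_imp_inj_to_nat_seg[OF assms(1)] by blast
  \<comment> \<open>The standard monomials; relabelling by \<open>g\<close> turns the lexicographic order into a monomial order.\<close>
  define B where "B = {m. keys m \<subseteq> X \<and>
      (\<forall>m'. keys m' \<subseteq> X \<longrightarrow> expo a m' = expo a m \<longrightarrow> relabel g m \<le> relabel g m')}"
  have "order_ideal X B"
    unfolding order_ideal_def
  proof (intro conjI ballI allI impI)
    show "keys m \<subseteq> X" if "m \<in> B" for m using that by (simp add: B_def)
    fix m n assume mn: "m + n \<in> B"
    have "relabel g m \<le> relabel g m'" if "keys m' \<subseteq> X" "expo a m' = expo a m" for m'
    proof -
      have "keys (m' + n) \<subseteq> X" using mn that(1) by (auto simp: B_def keys_add_nat)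
      moreover have "expo a (m' + n) = expo a (m + n)" by (simp add: expo_add that)
      ultimately have "relabel g (m + n) \<le> relabel g (m' + n)"
        using mn unfolding B_def by blast
      then show ?thesis by (simp add: expo_add)
    qed
    then show "m \<in> B" using mn by (auto simp: B_def keys_add_nat)
  qed
  moreover have "bij_betw (expo a) {m \<in> B. monom_degree m = d} (expo a ` monoms X d)" for d
    unfolding bij_betw_def
  proof
    show "inj_on (expo a) {m \<in> B. monom_degree m = d}"
    proof (rule inj_onI)
      fix m m' assume *: "m \<in> {m \<in> B. monom_degree m = d}" "m' \<in> {m \<in> B. monom_degree m = d}"
        "expo a m = expo a m'"
      then have "relabel g m = relabel g m'" by (auto simp: B_def intro: antisym)
      then show "m = m'"
        using inj_on_relabel[OF g assms(1)] * by (auto simp: B_def inj_on_def)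
    qed
    show "expo a ` {m \<in> B. monom_degree m = d} = expo a ` monoms X d"
    proof (intro equalityI subsetI)
      fix t assume "t \<in> expo a ` monoms X d"
      then obtain m where m: "keys m \<subseteq> X" "monom_degree m = d" "t = expo a m"
        by (auto simp: monoms_def)
      have deg: "monom_degree m' = d" if "keys m' \<subseteq> X" "expo a m' = t" for m'
        using monom_degree_expo[of X a w m', OF assms(2) that(1)] monom_degree_expo[of X a w m, OF assms(2) m(1)]
          that(2) m(2,3) assms(3) by simp
      let ?F = "{m'. keys m' \<subseteq> X \<and> expo a m' = t}"
      have "finite ?F"
        by (rule finite_subset[OF _ finite_monoms[OF assms(1), of d]]) (use deg in \<open>auto simp: monoms_def\<close>)
      then have fin: "finite (relabel g ` ?F)" by (rule finite_imageI)
      have "relabel g ` ?F \<noteq> {}" using m by auto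
      then have "Min (relabel g ` ?F) \<in> relabel g ` ?F" using Min_in[OF fin] by blast
      then obtain m' where m': "m' \<in> ?F" "Min (relabel g ` ?F) = relabel g m'" by (elim imageE)
      have "relabel g m' \<le> relabel g n" if "n \<in> ?F" for n
        using Min_le[OF fin imageI[OF that]] m'(2) by metis
      then have "m' \<in> B" using m'(1) unfolding B_def by blast
      then show "t \<in> expo a ` {m \<in> B. monom_degree m = d}"
        using m' deg by auto
    qed (auto simp: B_def monoms_def)
  qed
  then have "card (expo a ` monoms X d) = card {m \<in> B. monom_degree m = d}" for d
    using bij_betw_same_card by metis
  ultimately show ?thesis
    using gen_fun_order_ideal_rational[OF assms(1)] by (simp add: gen_fun_def)
qed

section \<open>Growth of the coefficients of a rational series\<close>

lemma fps_nth_eq_sum_diff: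
  fixes F :: "int fps"
  shows "fps_nth F n = (\<Sum>i\<le>n. fps_nth (F * (1 - fps_X)) i)"
  by (induction n) (simp_all add: algebra_simps)

lemma fps_of_poly_one_minus_X: "fps_of_poly [:1, -1:] = (1 - fps_X :: int fps)"
  by (simp add: fps_of_poly_pCons)

lemma one_minus_fps_X_neq_0: "(1 - fps_X :: int fps) \<noteq> 0"
  by (metis fps_of_poly_one_minus_X fps_of_poly_eq_iff fps_of_poly_0 pCons_eq_0_iff one_neq_zero)

lemma poly_at_1: "poly k (1::int) = (\<Sum>i\<le>Polynomial.degree k. poly.coeff k i)"
  by (simp add: poly_altdef)

text \<open>Multiplying by \<open>1 / (1 - t)\<close> means taking partial sums, which raises the growth exponent by at most
  one.\<close>

lemma rational_coeff_bound:
  fixes F :: "int fps"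
  assumes "F * (1 - fps_X) ^ Suc N = fps_of_poly q"
  shows "\<exists>C\<ge>0. \<forall>n. \<bar>fps_nth F n\<bar> \<le> C * int (n + 1) ^ N"
  using assms
proof (induction N arbitrary: F)
  case 0
  have "\<bar>fps_nth F n\<bar> \<le> (\<Sum>i\<le>Polynomial.degree q. \<bar>poly.coeff q i\<bar>)" for n
  proof -
    have "\<bar>fps_nth F n\<bar> \<le> (\<Sum>i\<le>n. \<bar>poly.coeff q i\<bar>)"
      using fps_nth_eq_sum_diff[of F n] 0 by (simp add: sum_abs)
    also have "\<dots> \<le> (\<Sum>i\<le>max n (Polynomial.degree q). \<bar>poly.coeff q i\<bar>)" by (rule sum_mono2) auto
    also have "\<dots> = (\<Sum>i\<le>Polynomial.degree q. \<bar>poly.coeff q i\<bar>)"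
      by (rule sum.mono_neutral_right) (auto simp: coeff_eq_0)
    finally show ?thesis .
  qed
  then show ?case by (intro exI[of _ "\<Sum>i\<le>Polynomial.degree q. \<bar>poly.coeff q i\<bar>"]) (simp add: sum_nonneg)
next
  case (Suc N)
  have "(F * (1 - fps_X)) * (1 - fps_X) ^ Suc N = fps_of_poly q"
    using Suc.prems by (simp add: mult.assoc)
  then obtain C where C: "C \<ge> 0" "\<And>n. \<bar>fps_nth (F * (1 - fps_X)) n\<bar> \<le> C * int (n + 1) ^ N"
    using Suc.IH by blast
  have "\<bar>fps_nth F n\<bar> \<le> C * int (n + 1) ^ Suc N" for n
  proof -
    have "\<bar>fps_nth F n\<bar> \<le> (\<Sum>i\<le>n. \<bar>fps_nth (F * (1 - fps_X)) i\<bar>)"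
      by (subst fps_nth_eq_sum_diff) (rule sum_abs)
    also have "\<dots> \<le> (\<Sum>i\<le>n. C * int (n + 1) ^ N)"
      by (rule sum_mono, rule order_trans[OF C(2)]) (use C(1) in \<open>auto intro!: mult_left_mono power_mono\<close>)
    finally show ?thesis by (simp add: algebra_simps)
  qed
  then show ?case using C(1) by blast
qed

text \<open>The expansion of \<open>1 / (1 - t)\<^sup>N\<^sup>+\<^sup>1\<close>, by Pascal's rule.\<close>

lemma fps_binomial_series:
  "Abs_fps (\<lambda>n. int ((n + N) choose N)) * (1 - fps_X) ^ Suc N = 1"
proof (induction N)
  case 0
  show ?case
    by (rule fps_ext) (simp add: algebra_simps)
next
  case (Suc N)
  have "Abs_fps (\<lambda>n. int ((n + Suc N) choose Suc N)) * (1 - fps_X) = Abs_fps (\<lambda>n. int ((n + N) choose N))"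
  proof (rule fps_ext)
    fix n
    show "fps_nth (Abs_fps (\<lambda>n. int ((n + Suc N) choose Suc N)) * (1 - fps_X)) n =
        fps_nth (Abs_fps (\<lambda>n. int ((n + N) choose N))) n"
      by (cases n) (simp_all add: right_diff_distrib)
  qed
  then show ?case using Suc.IH by (simp add: mult.assoc[symmetric])
qed

lemma power_le_fact_mult_binomial: "(n + 1) ^ N \<le> fact N * ((n + N) choose N)"
proof (induction N)
  case (Suc N)
  have "Suc N * ((n + Suc N) choose Suc N) = (n + Suc N) * ((n + N) choose N)"
    using Suc_times_binomial[of N "n + N"] by simp
  note rec = this
  have "fact (Suc N) * ((n + Suc N) choose Suc N) = fact N * (Suc N * ((n + Suc N) choose Suc N))"
    by (simp only: fact_Suc of_nat_id ac_simps)
  also have "\<dots> = (n + Suc N) * (fact N * ((n + N) choose N))"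
    by (simp only: rec ac_simps)
  finally have "fact (Suc N) * ((n + Suc N) choose Suc N) = (n + Suc N) * (fact N * ((n + N) choose N))" .
  moreover have "(n + 1) ^ Suc N \<le> (n + Suc N) * (fact N * ((n + N) choose N))"
    using mult_mono[OF _ Suc.IH, of "n + 1" "n + Suc N"] by simp
  ultimately show ?case by simp
qed simp

text \<open>Write \<open>k = k(1) + (1 - t) q\<close>. Then \<open>F\<close> is \<open>k(1) / (1 - t)\<^sup>N\<^sup>+\<^sup>1\<close>, whose coefficients are
  \<open>k(1)\<close> times binomial coefficients of order \<open>n\<^sup>N / N!\<close>, plus \<open>q / (1 - t)\<^sup>N\<close>, whose coefficients
  grow more slowly. Since the coefficients of \<open>F\<close> are nonnegative, this forces \<open>k(1) > 0\<close>.\<close>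

lemma rational_coeff_growth:
  fixes F :: "int fps"
  assumes "F * (1 - fps_X) ^ Suc N = fps_of_poly k" "poly k 1 \<noteq> 0" "\<And>n. fps_nth F n \<ge> 0"
  shows "poly k 1 > 0" "\<exists>n0. \<forall>n\<ge>n0. int (n + 1) ^ N \<le> 2 * fact N * fps_nth F n"
proof -
  let ?c = "poly k 1"
  let ?b = "\<lambda>n. int ((n + N) choose N)"
  have "[:-1, 1:] dvd k - [:?c:]" by (simp add: dvd_iff_poly_eq_0)
  then obtain q' where "k - [:?c:] = [:-1, 1:] * q'" by (elim dvdE)
  then have "k = [:?c:] + [:1, -1:] * (- q')" by (simp add: algebra_simps)
  then obtain q where k: "k = [:?c:] + [:1, -1:] * q" by blast
  define R where "R = F - fps_const ?c * Abs_fps ?b"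
  have "R * (1 - fps_X) ^ Suc N = fps_of_poly k - fps_const ?c * 1"
    unfolding R_def left_diff_distrib assms(1) mult.assoc fps_binomial_series by simp
  also have "\<dots> = (1 - fps_X) * fps_of_poly q"
    by (subst k) (simp only: fps_of_poly_add fps_of_poly_mult fps_of_poly_one_minus_X
        fps_of_poly_const, simp)
  finally have "(1 - fps_X) * (R * (1 - fps_X) ^ N) = (1 - fps_X) * fps_of_poly q"
    by (simp add: algebra_simps)
  then have R: "R * (1 - fps_X) ^ N = fps_of_poly q"
    by (simp only: mult_left_cancel[OF one_minus_fps_X_neq_0])
  have small: "\<exists>n0. \<forall>n\<ge>n0. 2 * fact N * \<bar>fps_nth R n\<bar> < int (n + 1) ^ N"
  proof (cases N)
    case 0
    then have "fps_nth R n = 0" if "n \<ge> Suc (Polynomial.degree q)" for n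
      using R that by (simp add: coeff_eq_0)
    then show ?thesis using 0 by (intro exI[of _ "Suc (Polynomial.degree q)"]) simp
  next
    case (Suc M)
    then obtain C where C: "C \<ge> 0" "\<And>n. \<bar>fps_nth R n\<bar> \<le> C * int (n + 1) ^ M"
      using rational_coeff_bound[of R M q] R by blast
    have "2 * fact N * \<bar>fps_nth R n\<bar> < int (n + 1) ^ N" if "n \<ge> nat (2 * fact N * C)" for n
    proof -
      have "2 * fact N * \<bar>fps_nth R n\<bar> \<le> 2 * fact N * (C * int (n + 1) ^ M)"
        using C(2) by (intro mult_left_mono) auto
      also have "\<dots> = (2 * fact N * C) * int (n + 1) ^ M" by simp
      also have "\<dots> < int (n + 1) * int (n + 1) ^ M"
        using that by (intro mult_strict_right_mono) auto
      finally show ?thesis by (simp add: Suc)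
    qed
    then show ?thesis by blast
  qed
  then obtain n0 where n0: "\<And>n. n \<ge> n0 \<Longrightarrow> 2 * fact N * \<bar>fps_nth R n\<bar> < int (n + 1) ^ N" by blast
  have F: "fps_nth F n = ?c * ?b n + fps_nth R n" for n by (simp add: R_def)
  have b: "int (n + 1) ^ N \<le> fact N * ?b n" for n
    using power_le_fact_mult_binomial[of n N] by (metis of_nat_fact of_nat_le_iff of_nat_mult of_nat_power)
  have bpos: "fact N * ?b n > 0" for n by simp
  have fpos: "fact N > (0::int)" by simp
  show pos: "?c > 0"
  proof (rule ccontr)
    assume "\<not> ?c > 0"
    then have "?c \<le> -1" using assms(2) by simp
    then have "?c * (fact N * ?b n0) \<le> -1 * (fact N * ?b n0)"
      by (intro mult_right_mono) auto
    moreover have "0 \<le> fact N * fps_nth F n0" using assms(3) by simp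
    moreover have "fact N * fps_nth F n0 = ?c * (fact N * ?b n0) + fact N * fps_nth R n0"
      by (simp add: F algebra_simps)
    moreover have "fact N * fps_nth R n0 \<le> fact N * \<bar>fps_nth R n0\<bar>" by (intro mult_left_mono) auto
    moreover have "0 \<le> fact N * \<bar>fps_nth R n0\<bar>" by simp
    moreover have "2 * (fact N * \<bar>fps_nth R n0\<bar>) < int (n0 + 1) ^ N" using n0[of n0] by simp
    ultimately show False using b[of n0] by linarith
  qed
  show "\<exists>n0. \<forall>n\<ge>n0. int (n + 1) ^ N \<le> 2 * fact N * fps_nth F n"
  proof (intro exI allI impI)
    fix n assume "n \<ge> n0"
    have "1 * (fact N * ?b n) \<le> ?c * (fact N * ?b n)" using pos by (intro mult_right_mono) auto
    moreover have "fact N * fps_nth F n = ?c * (fact N * ?b n) + fact N * fps_nth R n"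
      by (simp add: F algebra_simps)
    moreover have "- (fact N * fps_nth R n) \<le> fact N * \<bar>fps_nth R n\<bar>"
      unfolding mult_minus_right[symmetric] by (intro mult_left_mono) auto
    moreover have "2 * (fact N * \<bar>fps_nth R n\<bar>) < int (n + 1) ^ N" using n0[OF \<open>n \<ge> n0\<close>] by simp
    ultimately have "int (n + 1) ^ N \<le> 2 * (fact N * fps_nth F n)" using b[of n] by linarith
    then show "int (n + 1) ^ N \<le> 2 * fact N * fps_nth F n" by simp
  qed
qed

text \<open>With the least possible exponent \<open>e\<close>, a zero of the numerator at \<open>1\<close> could be cancelled against a
  factor \<open>1 - t\<close>. For \<open>e = 0\<close> there is no factor left, but then \<open>F\<close> is a polynomial with
  nonnegative coefficients and a positive constant term.\<close>

lemma rational_minimal_denominator: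
  fixes F :: "int fps"
  assumes "F * (1 - fps_X) ^ N = fps_of_poly q" "\<And>n. fps_nth F n \<ge> 0" "fps_nth F 0 > 0"
  shows "\<exists>e k. F * (1 - fps_X) ^ e = fps_of_poly k \<and> poly k 1 \<noteq> 0"
proof -
  define e where "e = (LEAST e. \<exists>k. F * (1 - fps_X) ^ e = fps_of_poly k)"
  have "\<exists>k. F * (1 - fps_X) ^ e = fps_of_poly k"
    unfolding e_def by (rule LeastI[of "\<lambda>e. \<exists>k. F * (1 - fps_X) ^ e = fps_of_poly k" N])
      (use assms(1) in blast)
  then obtain k where k: "F * (1 - fps_X) ^ e = fps_of_poly k" by blast
  have "poly k 1 \<noteq> 0"
  proof (cases e)
    case 0
    then have F: "fps_nth F n = poly.coeff k n" for n using k by simp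
    have "poly.coeff k 0 \<le> (\<Sum>i\<le>Polynomial.degree k. poly.coeff k i)"
      by (rule member_le_sum) (use F assms(2) in \<open>auto simp flip: F\<close>)
    then show ?thesis using assms(3) F[of 0] by (simp add: poly_at_1)
  next
    case (Suc e')
    show ?thesis
    proof
      assume "poly k 1 = 0"
      then have "[:-1, 1:] dvd k" by (simp add: dvd_iff_poly_eq_0)
      then obtain q' where "k = [:-1, 1:] * q'" by (elim dvdE)
      then have k': "k = [:1, -1:] * (- q')" by (simp add: algebra_simps)
      have "(1 - fps_X) * (F * (1 - fps_X) ^ e') = (1 - fps_X) * fps_of_poly (- q')"
        using k unfolding Suc by (subst (asm) k') (simp only: fps_of_poly_mult
            fps_of_poly_one_minus_X, simp add: algebra_simps)
      then have "F * (1 - fps_X) ^ e' = fps_of_poly (- q')"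
        by (simp only: mult_left_cancel[OF one_minus_fps_X_neq_0])
      then have "e \<le> e'" unfolding e_def by (intro Least_le) blast
      then show False using Suc by simp
    qed
  qed
  then show ?thesis using k by blast
qed

section \<open>The Hilbert function counts exponent vectors\<close>

lemma in_poly_ring_iff: "p \<in> carrier (poly_ring X) \<longleftrightarrow> (\<forall>m\<in>keys p. keys m \<subseteq> X)"
  by (simp add: poly_ring_def)

lemma poly_ring_ops:
  "mult (poly_ring X) = (*)" "add (poly_ring X) = (+)" "one (poly_ring X) = 1" "zero (poly_ring X) = 0"
  by (simp_all add: poly_ring_def)

lemma poly_ring_add_closed:
  assumes "p \<in> carrier (poly_ring X)" "q \<in> carrier (poly_ring X)"
  shows "p + q \<in> carrier (poly_ring X)"
proof -
  interpret cring "poly_ring X" by (rule cring_poly_ring)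
  show ?thesis using a_closed[OF assms] by (simp add: poly_ring_ops)
qed

lemma poly_ring_mult_closed:
  assumes "p \<in> carrier (poly_ring X)" "q \<in> carrier (poly_ring X)"
  shows "p * q \<in> carrier (poly_ring X)"
proof -
  interpret cring "poly_ring X" by (rule cring_poly_ring)
  show ?thesis using m_closed[OF assms] by (simp add: poly_ring_ops)
qed

lemma poly_ring_sum_closed:
  assumes "\<And>i. i \<in> A \<Longrightarrow> f i \<in> carrier (poly_ring X)"
  shows "(\<Sum>i\<in>A. f i) \<in> carrier (poly_ring X)"
  using assms
  by (induction A rule: infinite_finite_induct) (simp_all add: poly_ring_add_closed, simp_all add: in_poly_ring_iff)

lemma poly_ring_a_inv:
  assumes "p \<in> carrier (poly_ring X)"
  shows "\<ominus>\<^bsub>poly_ring X\<^esub> p = - p"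
proof -
  interpret cring "poly_ring X" by (rule cring_poly_ring)
  have "- p \<in> carrier (poly_ring X)" using assms by (simp add: in_poly_ring_iff)
  then show ?thesis using minus_equality[of "- p" p] assms by (simp add: poly_ring_ops)
qed

lemma poly_ring_minus:
  assumes "p \<in> carrier (poly_ring X)" "q \<in> carrier (poly_ring X)"
  shows "p \<ominus>\<^bsub>poly_ring X\<^esub> q = p - q"
  using assms by (simp add: a_minus_def poly_ring_a_inv poly_ring_ops)

lemma single_in_poly_ring: "keys m \<subseteq> X \<Longrightarrow> single m c \<in> carrier (poly_ring X)"
  by (simp add: in_poly_ring_iff)

lemma monomial_map_ring_hom:
  "ring_hom_cring (poly_ring X) (poly_ring UNIV) (monomial_map a)"
  unfolding monomial_map_def by (rule poly_hom_ring_hom) (simp add: in_poly_ring_iff)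

lemma a_kernel_monomial_map:
  "a_kernel (poly_ring X) (poly_ring Y) (monomial_map a) = toric_kernel X a"
  by (simp add: a_kernel_def kernel_def toric_kernel_def poly_ring_ops)

lemma ideal_toric_kernel: "ideal (toric_kernel X a :: ('x, 'k::field) mpoly set) (poly_ring X)"
proof -
  interpret ring_hom_cring "poly_ring X :: ('x, 'k) mpoly ring" "poly_ring UNIV" "monomial_map a"
    by (rule monomial_map_ring_hom)
  have "ring_hom_ring (poly_ring X :: ('x, 'k) mpoly ring) (poly_ring UNIV) (monomial_map a)"
    by (rule ring_hom_ringI2[OF R.ring_axioms S.ring_axioms homh])
  from ring_hom_ring.kernel_is_ideal[OF this] show ?thesis
    by (simp add: a_kernel_monomial_map)
qed

text \<open>The quotient by the kernel is the image: residue classes can be compared after applying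
  \<open>monomial_map a\<close>.\<close>

lemma toric_coset_eq_iff:
  fixes p q :: "('x, 'k::field) mpoly"
  assumes "p \<in> carrier (poly_ring X)" "q \<in> carrier (poly_ring X)"
  shows "toric_kernel X a +>\<^bsub>poly_ring X\<^esub> p = toric_kernel X a +>\<^bsub>poly_ring X\<^esub> q \<longleftrightarrow>
    monomial_map a p = monomial_map a q"
proof -
  interpret cring "poly_ring X :: ('x, 'k) mpoly ring" by (rule cring_poly_ring)
  have "p - q \<in> carrier (poly_ring X)"
    using minus_closed[OF assms] by (simp add: poly_ring_minus[OF assms])
  then show ?thesis
    using quotient_eq_iff_same_a_r_cos[OF ideal_toric_kernel assms, of a]
    by (simp add: poly_ring_minus[OF assms] toric_kernel_def monomial_map_diff)
qed

lemma subfield_range_const: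
  "subfield (range const :: ('x, 'k::field) mpoly set) (poly_ring X)"
proof -
  interpret cring "poly_ring X :: ('x, 'k) mpoly ring" by (rule cring_poly_ring)
  let ?K = "range const :: ('x, 'k) mpoly set"
  let ?R = "poly_ring X :: ('x, 'k) mpoly ring"
  have c0: "const 0 = (0 :: ('x, 'k) mpoly)" and c1: "const 1 = (1 :: ('x, 'k) mpoly)"
    by (simp_all add: const_def)
  have sub: "subring ?K ?R"
  proof (rule subringI)
    show "?K \<subseteq> carrier ?R" by (auto simp: const_in_poly_ring)
    show "\<one>\<^bsub>?R\<^esub> \<in> ?K" using c1 by (auto simp: poly_ring_ops intro: range_eqI[of _ _ 1])
    show "\<ominus>\<^bsub>?R\<^esub> h \<in> ?K" if "h \<in> ?K" for h
      using that by (auto simp: const_in_poly_ring poly_ring_a_inv) (auto simp: const_def simp flip: single_uminus)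
    show "h1 \<otimes>\<^bsub>?R\<^esub> h2 \<in> ?K" if "h1 \<in> ?K" "h2 \<in> ?K" for h1 h2
      using that by (auto simp: poly_ring_ops simp flip: const_mult)
    show "h1 \<oplus>\<^bsub>?R\<^esub> h2 \<in> ?K" if "h1 \<in> ?K" "h2 \<in> ?K" for h1 h2
      using that by (auto simp: poly_ring_ops simp flip: const_add)
  qed
  show ?thesis
  proof (rule subfieldI)
    show "subcring ?K ?R"
      by (rule subcringI[OF sub]) (simp add: poly_ring_ops mult.commute)
    show "Units (?R\<lparr>carrier := ?K\<rparr>) = ?K - {\<zero>\<^bsub>?R\<^esub>}"
    proof (intro equalityI subsetI)
      fix u assume "u \<in> Units (?R\<lparr>carrier := ?K\<rparr>)"
      then show "u \<in> ?K - {\<zero>\<^bsub>?R\<^esub>}" by (auto simp: Units_def poly_ring_ops)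
    next
      fix u assume "u \<in> ?K - {\<zero>\<^bsub>?R\<^esub>}"
      then obtain c where c: "u = const c" "u \<noteq> 0" by (auto simp: poly_ring_ops)
      then have "c \<noteq> 0" using c0 by auto
      then have "const (inverse c) * u = 1" "u * const (inverse c) = 1"
        unfolding c(1) by (simp_all add: c1 flip: const_mult)
      then show "u \<in> Units (?R\<lparr>carrier := ?K\<rparr>)"
        using c unfolding Units_def by (auto simp: poly_ring_ops)
    qed
  qed
qed

text \<open>In the quotient, monomials with the same image agree, and monomials with distinct images are linearly
  independent. The dimension is built up one image \<open>t\<close> at a time: \<open>E T\<close> consists of the forms
  all of whose monomials are mapped into \<open>T\<close>, and adding \<open>t\<close> to \<open>T\<close> extends the class of \<open>E T\<close> by the line
  through the class of one monomial over \<open>t\<close>.\<close>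

lemma hilbert_function_toric_kernel:
  fixes a :: "'x \<Rightarrow> ('y \<Rightarrow>\<^sub>0 nat)"
  assumes "finite X"
  shows "hilbert_function X (toric_kernel X a :: ('x, 'k::field) mpoly set) d = card (expo a ` monoms X d)"
proof -
  let ?R = "poly_ring X :: ('x, 'k) mpoly ring"
  let ?I = "toric_kernel X a :: ('x, 'k) mpoly set"
  let ?Q = "?R Quot ?I"
  let ?\<pi> = "\<lambda>p. ?I +>\<^bsub>?R\<^esub> p"
  let ?K = "?\<pi> ` range const"
  interpret I: ideal ?I ?R by (rule ideal_toric_kernel)
  interpret \<pi>: ring_hom_ring ?R ?Q ?\<pi> by (rule I.rcos_ring_hom_ring)
  have zero: "\<zero>\<^bsub>?Q\<^esub> = ?\<pi> 0" and one: "\<one>\<^bsub>?Q\<^esub> = ?\<pi> 1"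
    using \<pi>.hom_zero \<pi>.hom_one by (simp_all add: poly_ring_ops)
  have mem0: "(0 :: ('x, 'k) mpoly) \<in> carrier ?R" and mem1: "(1 :: ('x, 'k) mpoly) \<in> carrier ?R"
    by (simp_all add: in_poly_ring_iff)
  have "monomial_map a (1 :: ('x, 'k) mpoly) \<noteq> monomial_map a 0"
    using monomial_map_const[of a "1 :: 'k"] by (simp add: const_def)
  then have "\<one>\<^bsub>?Q\<^esub> \<noteq> \<zero>\<^bsub>?Q\<^esub>"
    unfolding zero one using toric_coset_eq_iff[OF mem1 mem0, of a] by simp
  then have K: "subfield ?K ?Q" by (rule \<pi>.img_is_subfield(2)[OF subfield_range_const])
  define E :: "('y \<Rightarrow>\<^sub>0 nat) set \<Rightarrow> ('x, 'k) mpoly set" where "E T = {p \<in> homogeneous_part X d. expo a ` keys p \<subseteq> T}" for T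
  have E_carrier: "p \<in> carrier ?R" if "p \<in> E T" for p :: "('x, 'k) mpoly" and T
    using that by (simp add: E_def homogeneous_part_def)
  have dim: "\<pi>.S.dimension (card T) ?K (?\<pi> ` E T)" if "finite T" "T \<subseteq> expo a ` monoms X d" for T
    using that
  proof (induction T)
    case empty
    have "E {} = {0 :: ('x, 'k) mpoly}" by (auto simp: E_def homogeneous_part_def in_poly_ring_iff)
    then have "?\<pi> ` E {} = {\<zero>\<^bsub>?Q\<^esub>}" using zero by simp
    then show ?case by simp
  next
    case (insert t T)
    obtain m where m: "m \<in> monoms X d" "t = expo a m" using insert.prems by blast
    have mX: "keys m \<subseteq> X" "monom_degree m = d" using m by (auto simp: monoms_def)
    have sing: "single m c \<in> carrier ?R" for c using mX by (simp add: single_in_poly_ring)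
    let ?v = "?\<pi> (single m 1)"
    have "?v \<notin> ?\<pi> ` E T"
    proof
      assume "?v \<in> ?\<pi> ` E T"
      then obtain p where p: "p \<in> E T" "?v = ?\<pi> p" by blast
      then have "monomial_map a (single m 1) = monomial_map a p"
        using toric_coset_eq_iff[OF sing E_carrier] by blast
      then have "lookup (monomial_map a p) t = 1" by (metis lookup_single_eq m(2) monomial_map_single)
      moreover have "{m' \<in> keys p. expo a m' = t} = {}"
        using p(1) insert.hyps by (auto simp: E_def)
      ultimately show False by (simp add: lookup_monomial_map)
    qed
    then have "\<pi>.S.dimension (Suc (card T)) ?K (\<pi>.S.line_extension ?K ?v (?\<pi> ` E T))"
      using insert sing by (intro \<pi>.S.dimension.Suc_dim \<pi>.hom_closed) auto
    moreover have "\<pi>.S.line_extension ?K ?v (?\<pi> ` E T) = ?\<pi> ` E (insert t T)"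
    proof (intro equalityI subsetI)
      fix y assume "y \<in> \<pi>.S.line_extension ?K ?v (?\<pi> ` E T)"
      then obtain c p where cp: "p \<in> E T" "y = (?\<pi> (const c) \<otimes>\<^bsub>?Q\<^esub> ?v) \<oplus>\<^bsub>?Q\<^esub> ?\<pi> p"
        by (auto simp: \<pi>.S.line_extension_def set_add_def' r_coset_def)
      have "y = ?\<pi> (single m c + p)"
      proof -
        have "?\<pi> (const c) \<otimes>\<^bsub>?Q\<^esub> ?v = ?\<pi> (single m c)"
          using \<pi>.hom_mult[OF const_in_poly_ring sing, of c 1]
          by (simp add: poly_ring_ops const_def mult_single)
        then show ?thesis
          using cp \<pi>.hom_add[OF sing E_carrier[OF cp(1)], of c] by (simp add: poly_ring_ops)
      qed
      moreover have "single m c + p \<in> E (insert t T)"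
      proof -
        have "keys (single m c + p) \<subseteq> insert m (keys p)"
          using Poly_Mapping.keys_add[of "single m c" p] by (auto split: if_splits)
        then show ?thesis
          using cp(1) mX m unfolding E_def homogeneous_part_def in_poly_ring_iff by blast
      qed
      ultimately show "y \<in> ?\<pi> ` E (insert t T)" by blast
    next
      fix y assume "y \<in> ?\<pi> ` E (insert t T)"
      then obtain p where p: "p \<in> E (insert t T)" "y = ?\<pi> p" by blast
      define c where "c = lookup (monomial_map a p) t"
      \<comment> \<open>\<open>p2\<close> collects the monomials over \<open>T\<close>; the others add up to \<open>c\<close> times the monomial over \<open>t\<close>.\<close>
      define p2 where "p2 = (\<Sum>m\<in>{m \<in> keys p. expo a m \<noteq> t}. single m (lookup p m))"
      have keys2: "keys p2 \<subseteq> {m \<in> keys p. expo a m \<noteq> t}"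
        unfolding p2_def by (rule order_trans[OF keys_sum]) auto
      have p2: "p2 \<in> E T"
        using keys2 p(1) unfolding E_def homogeneous_part_def in_poly_ring_iff by blast
      have split: "p = (\<Sum>m\<in>{m \<in> keys p. expo a m = t}. single m (lookup p m)) + p2"
        unfolding p2_def
        by (subst mpoly_expand[of p], subst sum.union_disjoint[symmetric]) (auto intro: sum.cong)
      have "monomial_map a (\<Sum>m\<in>{m \<in> keys p. expo a m = t}. single m (lookup p m)) =
          (\<Sum>m\<in>{m \<in> keys p. expo a m = t}. single t (lookup p m))"
        by (simp add: monomial_map_sum monomial_map_single)
      then have "monomial_map a p = (\<Sum>m\<in>{m \<in> keys p. expo a m = t}. single t (lookup p m)) + monomial_map a p2"
        by (metis (mono_tags, lifting) monomial_map_add split)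
      also have "(\<Sum>m\<in>{m \<in> keys p. expo a m = t}. single t (lookup p m)) = monomial_map a (single m c)"
        unfolding c_def lookup_monomial_map monomial_map_single m(2)[symmetric]
        by (rule poly_mapping_eqI) (simp add: lookup_sum lookup_single when_def)
      finally have "monomial_map a p = monomial_map a (single m c + p2)" by (simp add: monomial_map_add)
      then have "y = ?\<pi> (single m c + p2)"
        using toric_coset_eq_iff[OF E_carrier[OF p(1)] poly_ring_add_closed[OF sing E_carrier[OF p2]]]
          p(2) by blast
      also have "\<dots> = (?\<pi> (const c) \<otimes>\<^bsub>?Q\<^esub> ?v) \<oplus>\<^bsub>?Q\<^esub> ?\<pi> p2"
        using \<pi>.hom_mult[OF const_in_poly_ring sing, of c 1] \<pi>.hom_add[OF sing E_carrier[OF p2], of c]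
        by (simp add: poly_ring_ops const_def mult_single)
      finally show "y \<in> \<pi>.S.line_extension ?K ?v (?\<pi> ` E T)"
        using p2 by (auto simp: \<pi>.S.line_extension_def set_add_def' r_coset_def)
    qed
    ultimately show ?case using insert.hyps by simp
  qed
  have "E (expo a ` monoms X d) = homogeneous_part X d"
    by (auto simp: E_def homogeneous_part_def monoms_def in_poly_ring_iff)
  then have "\<pi>.S.dimension (card (expo a ` monoms X d)) ?K (?\<pi> ` homogeneous_part X d)"
    using dim[of "expo a ` monoms X d"] finite_monoms[OF assms] by simp
  then show ?thesis
    unfolding hilbert_function_def using \<pi>.S.dimI[OF K] by (simp add: over_def)
qed

section \<open>Chains of primes in a quotient ring\<close>

text \<open>Ideals that contain \<open>I\<close> are unions of cosets of \<open>I\<close>, hence are recovered from their images modulo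
  \<open>I\<close>. This turns chains of primes above \<open>I\<close> into chains of primes of the quotient.\<close>

lemma coset_in_image_iff:
  assumes "cring R" "ideal I R" "ideal J R" "I \<subseteq> J" "r \<in> carrier R"
  shows "I +>\<^bsub>R\<^esub> r \<in> (\<lambda>r. I +>\<^bsub>R\<^esub> r) ` J \<longleftrightarrow> r \<in> J"
proof
  interpret cring R by fact
  interpret J: ideal J R by fact
  assume "I +>\<^bsub>R\<^esub> r \<in> (\<lambda>r. I +>\<^bsub>R\<^esub> r) ` J"
  then obtain j where j: "j \<in> J" "I +>\<^bsub>R\<^esub> r = I +>\<^bsub>R\<^esub> j" by blast
  then have jc: "j \<in> carrier R" using J.Icarr by blast
  have "r \<ominus>\<^bsub>R\<^esub> j \<in> J"
    using quotient_eq_iff_same_a_r_cos[OF assms(2,5) jc] j assms(4) by blast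
  then have "(r \<ominus>\<^bsub>R\<^esub> j) \<oplus>\<^bsub>R\<^esub> j \<in> J" using j(1) by (rule J.a_closed)
  moreover have "(r \<ominus>\<^bsub>R\<^esub> j) \<oplus>\<^bsub>R\<^esub> j = r" using assms(5) jc by algebra
  ultimately show "r \<in> J" by simp
qed blast

lemma coset_surj:
  assumes "ideal I R" "a \<in> carrier (R Quot I)"
  obtains r where "r \<in> carrier R" "a = I +>\<^bsub>R\<^esub> r"
  using assms by (auto simp: FactRing_def A_RCOSETS_def')

lemma krull_dim_quot_ge:
  assumes "cring R" "ideal I R" "\<And>i. i \<le> n \<Longrightarrow> primeideal (P i) R"
    "\<And>i. i < n \<Longrightarrow> P i \<subset> P (Suc i)" "I \<subseteq> P 0"
  shows "enat n \<le> krull_dim (R Quot I)"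
proof -
  interpret cring R by fact
  interpret I: ideal I R by fact
  interpret \<pi>: ring_hom_ring R "R Quot I" "\<lambda>r. I +>\<^bsub>R\<^esub> r" by (rule I.rcos_ring_hom_ring)
  let ?\<pi> = "\<lambda>r. I +>\<^bsub>R\<^esub> r"
  have sub: "I \<subseteq> P i" if "i \<le> n" for i
    using that by (induction i) (use assms(4,5) in \<open>auto dest: Suc_le_lessD\<close>)
  have idl: "ideal (P i) R" if "i \<le> n" for i using assms(3)[OF that] by (simp add: primeideal_def)
  have mem: "?\<pi> r \<in> ?\<pi> ` P i \<longleftrightarrow> r \<in> P i" if "i \<le> n" "r \<in> carrier R" for i r
    using coset_in_image_iff[OF assms(1,2) idl[OF that(1)] sub[OF that(1)] that(2)] .
  have prime: "primeideal (?\<pi> ` P i) (R Quot I)" if i: "i \<le> n" for i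
  proof (rule primeidealI)
    interpret P: primeideal "P i" R using assms(3)[OF i] .
    show "ideal (?\<pi> ` P i) (R Quot I)" by (rule ring_ideal_imp_quot_ideal[OF assms(2) idl[OF i]])
    show "cring (R Quot I)" by (rule I.quotient_is_cring[OF assms(1)])
    obtain r where r: "r \<in> carrier R" "r \<notin> P i"
      using P.I_notcarr P.a_subset by blast
    then have "?\<pi> r \<in> carrier (R Quot I)" "?\<pi> r \<notin> ?\<pi> ` P i"
      using mem[OF i] by auto
    then show "carrier (R Quot I) \<noteq> ?\<pi> ` P i" by blast
    fix a b assume ab: "a \<in> carrier (R Quot I)" "b \<in> carrier (R Quot I)"
      "a \<otimes>\<^bsub>R Quot I\<^esub> b \<in> ?\<pi> ` P i"
    obtain r s where rs: "r \<in> carrier R" "a = ?\<pi> r" "s \<in> carrier R" "b = ?\<pi> s"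
      using coset_surj[OF assms(2) ab(1)] coset_surj[OF assms(2) ab(2)] by metis
    then have "?\<pi> (r \<otimes>\<^bsub>R\<^esub> s) \<in> ?\<pi> ` P i" using ab(3) by simp
    then have "r \<otimes>\<^bsub>R\<^esub> s \<in> P i" using mem[OF i m_closed[OF rs(1,3)]] by (rule iffD1[rotated])
    then have "r \<in> P i \<or> s \<in> P i" using P.I_prime rs by blast
    then show "a \<in> ?\<pi> ` P i \<or> b \<in> ?\<pi> ` P i" using rs by blast
  qed
  have strict: "?\<pi> ` P i \<subset> ?\<pi> ` P (Suc i)" if i: "i < n" for i
  proof -
    obtain r where r: "r \<in> P (Suc i)" "r \<notin> P i" using assms(4)[OF i] by blast
    then have rc: "r \<in> carrier R" using ideal.Icarr[OF idl[of "Suc i"]] i by simp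
    then have "?\<pi> r \<in> ?\<pi> ` P (Suc i)" "?\<pi> r \<notin> ?\<pi> ` P i"
      using r mem[of i r] i by auto
    moreover have "?\<pi> ` P i \<subseteq> ?\<pi> ` P (Suc i)" using assms(4)[OF i] by blast
    ultimately show ?thesis by blast
  qed
  show ?thesis
    unfolding krull_dim_def
    by (intro Sup_upper CollectI exI[of _ n] exI[of _ "\<lambda>i. ?\<pi> ` P i"] conjI refl allI impI prime strict)
qed

lemma zero_quot: "\<zero>\<^bsub>R Quot I\<^esub> = I"
  by (simp add: FactRing_def)

lemma krull_dim_quot_le:
  assumes "cring R" "ideal I R"
    "\<And>n Q. (\<And>i. i \<le> n \<Longrightarrow> primeideal (Q i) R) \<Longrightarrow> (\<And>i. i < n \<Longrightarrow> Q i \<subset> Q (Suc i)) \<Longrightarrow>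
       I \<subseteq> Q 0 \<Longrightarrow> n \<le> e"
  shows "krull_dim (R Quot I) \<le> enat e"
  unfolding krull_dim_def
proof (rule Sup_least, clarify)
  interpret cring R by fact
  interpret I: ideal I R by fact
  interpret \<pi>: ring_hom_ring R "R Quot I" "\<lambda>r. I +>\<^bsub>R\<^esub> r" by (rule I.rcos_ring_hom_ring)
  let ?\<pi> = "\<lambda>r. I +>\<^bsub>R\<^esub> r"
  fix n P assume P: "\<forall>i\<le>n. primeideal (P i) (R Quot I)" "\<forall>i<n. P i \<subset> P (Suc i)"
  define Q where "Q i = {r \<in> carrier R. ?\<pi> r \<in> P i}" for i
  have "n \<le> e"
  proof (rule assms(3))
    show "primeideal (Q i) R" if "i \<le> n" for i
      unfolding Q_def using P(1) that by (intro \<pi>.primeideal_vimage assms(1)) auto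
    show "Q i \<subset> Q (Suc i)" if i: "i < n" for i
    proof -
      obtain y where y: "y \<in> P (Suc i)" "y \<notin> P i" using P(2) i by blast
      have "primeideal (P (Suc i)) (R Quot I)" using P(1) i by (meson Suc_leI)
      then have "ideal (P (Suc i)) (R Quot I)" by (rule primeideal.axioms(1))
      then have "y \<in> carrier (R Quot I)" using y(1) by (rule ideal.Icarr)
      then obtain r where "r \<in> carrier R" "y = ?\<pi> r" by (rule coset_surj[OF assms(2)])
      then have "r \<in> Q (Suc i)" "r \<notin> Q i" using y by (auto simp: Q_def)
      moreover have "Q i \<subseteq> Q (Suc i)" using P(2) i by (auto simp: Q_def)
      ultimately show ?thesis by blast
    qed
    show "I \<subseteq> Q 0"
    proof
      fix r assume r: "r \<in> I"
      have "primeideal (P 0) (R Quot I)" using P(1) by blast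
      then have zP: "\<zero>\<^bsub>R Quot I\<^esub> \<in> P 0"
        by (rule additive_subgroup.zero_closed[OF ideal.axioms(1)[OF primeideal.axioms(1)]])
      have "\<zero>\<^bsub>R Quot I\<^esub> = ?\<pi> r" unfolding zero_quot by (rule sym, rule I.a_rcos_const[OF r])
      then have "?\<pi> r \<in> P 0" using zP by (rule subst)
      then show "r \<in> Q 0" unfolding Q_def using I.Icarr[OF r] by blast
    qed
  qed
  then show "enat n \<le> enat e" by simp
qed

section \<open>A chain of toric primes\<close>

text \<open>The image of \<open>monomial_map a\<close> lies in a polynomial ring, which is a domain.\<close>

lemma primeideal_toric_kernel: "primeideal (toric_kernel X a :: ('x, 'k::field) mpoly set) (poly_ring X)"
proof (rule primeidealI[OF ideal_toric_kernel cring_poly_ring])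
  have "(1 :: ('x, 'k) mpoly) \<in> carrier (poly_ring X)" by (simp add: in_poly_ring_iff)
  moreover have "monomial_map a (1 :: ('x, 'k) mpoly) \<noteq> 0"
    using monomial_map_const[of a "1 :: 'k"] by (simp add: const_def)
  ultimately show "carrier (poly_ring X) \<noteq> (toric_kernel X a :: ('x, 'k) mpoly set)"
    by (auto simp: toric_kernel_def)
next
  fix p q :: "('x, 'k) mpoly"
  assume *: "p \<in> carrier (poly_ring X)" "q \<in> carrier (poly_ring X)"
    "p \<otimes>\<^bsub>poly_ring X\<^esub> q \<in> toric_kernel X a"
  then have "monomial_map a p * monomial_map a q = 0"
    by (simp add: toric_kernel_def poly_ring_ops monomial_map_mult)
  then show "p \<in> toric_kernel X a \<or> q \<in> toric_kernel X a"
    using * mpoly_no_zero_divisors by (auto simp: toric_kernel_def)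
qed

text \<open>Forgetting the coordinates outside \<open>C\<close>, that is, setting the target variables outside \<open>C\<close> to \<open>1\<close>.\<close>

definition restrict_coords :: "'y set \<Rightarrow> ('x \<Rightarrow> ('y \<Rightarrow>\<^sub>0 nat)) \<Rightarrow> 'x \<Rightarrow> ('y \<Rightarrow>\<^sub>0 nat)" where
  "restrict_coords C a x = (\<Sum>y\<in>C. single y (lookup (a x) y))"

lemma lookup_expo_restrict_coords:
  assumes "finite C"
  shows "lookup (expo (restrict_coords C a) m) y = (if y \<in> C then lookup (expo a m) y else 0)"
proof -
  have "lookup (restrict_coords C a x) y = (if y \<in> C then lookup (a x) y else 0)" for x
    using assms by (simp add: restrict_coords_def lookup_sum lookup_single when_def)
  then show ?thesis by (simp add: lookup_expo)
qed

lemma lookup_expo_le: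
  assumes "\<And>x. x \<in> X \<Longrightarrow> lookup (a x) y \<le> B" "keys m \<subseteq> X"
  shows "lookup (expo a m) y \<le> B * monom_degree m"
proof -
  have "lookup (expo a m) y \<le> (\<Sum>x\<in>keys m. lookup m x * B)"
    unfolding lookup_expo by (rule sum_mono, rule mult_left_mono) (use assms in auto)
  then show ?thesis by (simp add: monom_degree_def sum_distrib_left mult.commute)
qed

text \<open>If \<open>u\<close> determines \<open>v\<close>, then \<open>v\<close> takes at most as many values as \<open>u\<close>.\<close>

lemma card_image_le_card_image:
  assumes "finite M" "\<And>m m'. m \<in> M \<Longrightarrow> m' \<in> M \<Longrightarrow> u m = u m' \<Longrightarrow> v m = v m'"
  shows "card (v ` M) \<le> card (u ` M)"
proof -
  define f where "f t = v (SOME m. m \<in> M \<and> u m = t)" for t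
  have "v m = f (u m)" if "m \<in> M" for m
    unfolding f_def by (rule assms(2)[OF that]) (use someI[of "\<lambda>m'. m' \<in> M \<and> u m' = u m" m] that in auto)
  then have "v ` M \<subseteq> f ` (u ` M)" by auto
  then show ?thesis using assms(1) by (meson card_image_le card_mono finite_imageI order_trans)
qed

text \<open>Set the target variables to \<open>1\<close> one after the other; each step enlarges the prime kernel or keeps it.
  If forgetting the coordinate \<open>c\<close> does not identify two exponent vectors of the semigroup, the number of
  vectors stays the same. If it does, a binomial witnesses that the kernel becomes strictly larger,
  and the number of vectors of degree at most \<open>d\<close> shrinks at most by the factor \<open>B * d + 1\<close>, the number
  of possible values of that coordinate. So the number of strict inclusions bounds the growth of the number of vectors, without
  any reference to the rank of a lattice.\<close>

lemma toric_prime_chain: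
  fixes a :: "'x \<Rightarrow> ('y \<Rightarrow>\<^sub>0 nat)"
  assumes "finite X" "finite C" "\<And>x y. x \<in> X \<Longrightarrow> lookup (a x) y \<le> B"
  shows "\<exists>n (P :: nat \<Rightarrow> ('x, 'k::field) mpoly set). (\<forall>i\<le>n. primeideal (P i) (poly_ring X)) \<and>
    (\<forall>i<n. P i \<subset> P (Suc i)) \<and> toric_kernel X (restrict_coords C a) \<subseteq> P 0 \<and>
    (\<forall>d. card (expo (restrict_coords C a) ` monoms_upto X d) \<le> (B * d + 1) ^ n)"
  using assms(2)
proof (induction C)
  case empty
  have "expo (restrict_coords {} a) m = 0" for m
    by (rule poly_mapping_eqI) (simp add: lookup_expo_restrict_coords)
  then have "card (expo (restrict_coords {} a) ` monoms_upto X d) \<le> card {0 :: 'y \<Rightarrow>\<^sub>0 nat}" for d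
    by (intro card_mono) auto
  then show ?case
    by (intro exI[of _ 0] exI[of _ "\<lambda>_. toric_kernel X (restrict_coords {} a)"])
      (simp add: primeideal_toric_kernel)
next
  case (insert c C)
  let ?u = "expo (restrict_coords C a)" and ?v = "expo (restrict_coords (insert c C) a)"
  obtain n and P :: "nat \<Rightarrow> ('x, 'k) mpoly set" where
    P: "\<And>i. i \<le> n \<Longrightarrow> primeideal (P i) (poly_ring X)" "\<And>i. i < n \<Longrightarrow> P i \<subset> P (Suc i)"
      "toric_kernel X (restrict_coords C a) \<subseteq> P 0" and
    card: "\<And>d. card (?u ` monoms_upto X d) \<le> (B * d + 1) ^ n"
    using insert.IH by blast
  have look: "lookup (?v m) y = (if y = c then lookup (expo a m) c else lookup (?u m) y)" for m y
    using insert.hyps by (simp add: lookup_expo_restrict_coords)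
  have vu: "?u m = ?u m'" if "?v m = ?v m'" for m m'
  proof (rule poly_mapping_eqI)
    fix y
    show "lookup (?u m) y = lookup (?u m') y"
      using arg_cong[OF that, of "\<lambda>t. lookup t y"] insert.hyps
      by (auto simp: lookup_expo_restrict_coords split: if_splits)
  qed
  have ker: "(toric_kernel X (restrict_coords (insert c C) a) :: ('x, 'k) mpoly set) \<subseteq>
      toric_kernel X (restrict_coords C a)"
    by (rule toric_kernel_mono) (rule vu)
  have fin: "finite (monoms_upto X d)" for d by (rule finite_monoms_upto[OF assms(1)])
  show ?case
  proof (cases "\<forall>m m'. keys m \<subseteq> X \<longrightarrow> keys m' \<subseteq> X \<longrightarrow> ?u m = ?u m' \<longrightarrow> ?v m = ?v m'")
    case True
    have "card (?v ` monoms_upto X d) \<le> (B * d + 1) ^ n" for d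
      by (rule order_trans[OF card_image_le_card_image[OF fin] card])
        (use True in \<open>auto simp: monoms_upto_def\<close>)
    then show ?thesis
      using P ker by (intro exI[of _ n] exI[of _ P]) blast
  next
    case False
    then obtain m m' where m: "keys m \<subseteq> X" "keys m' \<subseteq> X" "?u m = ?u m'" "?v m \<noteq> ?v m'" by blast
    let ?P = "case_nat (toric_kernel X (restrict_coords (insert c C) a)) P"
    have card': "card (?v ` monoms_upto X d) \<le> (B * d + 1) ^ Suc n" for d
    proof -
      \<comment> \<open>An exponent vector consists of its coordinates in \<open>C\<close> and its coordinate at \<open>c\<close>.\<close>
      let ?w = "\<lambda>m. (?u m, lookup (expo a m) c)"
      have "card (?v ` monoms_upto X d) \<le> card (?w ` monoms_upto X d)"
        by (rule card_image_le_card_image[OF fin]) (auto intro!: poly_mapping_eqI simp: look)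
      also have "\<dots> \<le> card ((?u ` monoms_upto X d) \<times> {..B * d})"
      proof (rule card_mono)
        show "finite ((?u ` monoms_upto X d) \<times> {..B * d})" using fin by simp
        have "lookup (expo a m) c \<le> B * d" if "m \<in> monoms_upto X d" for m
        proof -
          have "lookup (expo a m) c \<le> B * monom_degree m"
            by (rule lookup_expo_le[of X]) (use assms(3) that in \<open>auto simp: monoms_upto_def\<close>)
          also have "\<dots> \<le> B * d" using that by (simp add: monoms_upto_def)
          finally show ?thesis .
        qed
        then show "?w ` monoms_upto X d \<subseteq> (?u ` monoms_upto X d) \<times> {..B * d}" by auto
      qed
      also have "\<dots> = card (?u ` monoms_upto X d) * (B * d + 1)"
        by (simp add: card_cartesian_product)
      also have "\<dots> \<le> (B * d + 1) ^ n * (B * d + 1)" by (rule mult_right_mono[OF card]) simp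
      finally show ?thesis unfolding power_Suc2 .
    qed
    have "toric_kernel X (restrict_coords (insert c C) a) \<subset> P 0"
    proof -
      \<comment> \<open>The binomial of two monomials that become equal only when \<open>c\<close> is forgotten.\<close>
      let ?p = "single m 1 - single m' 1 :: ('x, 'k) mpoly"
      have "?p \<in> carrier (poly_ring X)"
        using m keys_diff[of "single m (1::'k)" "single m' 1"] by (auto simp: in_poly_ring_iff)
      then have "?p \<in> toric_kernel X (restrict_coords C a)"
        using m by (simp add: toric_kernel_def monomial_map_diff monomial_map_single)
      moreover have "lookup (monomial_map (restrict_coords (insert c C) a) ?p) (?v m) = 1"
        using m by (simp add: monomial_map_diff monomial_map_single lookup_minus lookup_single when_def)
      then have "?p \<notin> toric_kernel X (restrict_coords (insert c C) a)"
        by (auto simp: toric_kernel_def)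
      ultimately show ?thesis using ker P(3) by blast
    qed
    then have "?P i \<subset> ?P (Suc i)" if "i < Suc n" for i
      using that P(2) by (cases i) simp_all
    moreover have "primeideal (?P i) (poly_ring X)" if "i \<le> Suc n" for i
      using that P(1) by (cases i) (simp_all add: primeideal_toric_kernel)
    moreover have "toric_kernel X (restrict_coords (insert c C) a) \<subseteq> ?P 0" by simp
    ultimately show ?thesis
      using card' by (intro exI[of _ "Suc n"] exI[of _ ?P] conjI allI impI)
  qed
qed

section \<open>Chains of primes are no longer than the growth exponent\<close>

text \<open>Gaussian elimination: one equation is used to eliminate one unknown.\<close>

lemma underdetermined_system:
  fixes A :: "'i \<Rightarrow> 'j \<Rightarrow> 'k::field"
  assumes "finite M" "finite J" "card M < card J"
  shows "\<exists>c. (\<exists>j\<in>J. c j \<noteq> 0) \<and> (\<forall>x\<in>M. (\<Sum>j\<in>J. c j * A j x) = 0)"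
  using assms
proof (induction M arbitrary: J A)
  case empty
  then have "J \<noteq> {}" by auto
  then show ?case by (intro exI[of _ "\<lambda>_. 1"]) auto
next
  case (insert x M)
  show ?case
  proof (cases "\<forall>j\<in>J. A j x = 0")
    case True
    obtain c where c: "\<exists>j\<in>J. c j \<noteq> 0" "\<forall>y\<in>M. (\<Sum>j\<in>J. c j * A j y) = 0"
      using insert.IH[of J A] insert.prems insert.hyps by auto
    have "(\<Sum>j\<in>J. c j * A j x) = 0" using True by simp
    then show ?thesis using c by blast
  next
    case False
    then obtain j0 where j0: "j0 \<in> J" "A j0 x \<noteq> 0" by blast
    let ?J = "J - {j0}"
    let ?r = "\<lambda>j. A j x / A j0 x"
    have "card M < card ?J" using insert.prems insert.hyps j0 by simp
    then obtain c where c: "\<exists>j\<in>?J. c j \<noteq> 0"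
      "\<And>y. y \<in> M \<Longrightarrow> (\<Sum>j\<in>?J. c j * (A j y - ?r j * A j0 y)) = 0"
      using insert.IH[of ?J "\<lambda>j y. A j y - ?r j * A j0 y"] insert.prems by auto
    \<comment> \<open>The value of the eliminated unknown \<open>j0\<close> is forced by the equation for \<open>x\<close>.\<close>
    let ?c = "c(j0 := - (\<Sum>j\<in>?J. c j * ?r j))"
    have eq: "(\<Sum>j\<in>J. ?c j * A j y) = (\<Sum>j\<in>?J. c j * (A j y - ?r j * A j0 y))" for y
    proof -
      have "(\<Sum>j\<in>J. ?c j * A j y) = ?c j0 * A j0 y + (\<Sum>j\<in>?J. ?c j * A j y)"
        using insert.prems j0 by (subst sum.remove[of J j0]) auto
      also have "(\<Sum>j\<in>?J. ?c j * A j y) = (\<Sum>j\<in>?J. c j * A j y)" by (rule sum.cong) auto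
      also have "?c j0 * A j0 y = - (\<Sum>j\<in>?J. c j * (?r j * A j0 y))"
        by (simp add: sum_distrib_right mult.assoc)
      finally show ?thesis by (simp add: right_diff_distrib sum_subtractf)
    qed
    have "(\<Sum>j\<in>J. ?c j * A j x) = 0" unfolding eq using j0 by simp
    moreover have "\<exists>j\<in>J. ?c j \<noteq> 0" using c(1) by auto
    ultimately show ?thesis using c(2) eq by (intro exI[of _ ?c]) auto
  qed
qed

definition polys_upto :: "'x set \<Rightarrow> nat \<Rightarrow> ('x, 'k::field) mpoly set" where
  "polys_upto X d = {p. keys p \<subseteq> monoms_upto X d}"

lemma polys_upto_carrier: "p \<in> polys_upto X d \<Longrightarrow> p \<in> carrier (poly_ring X)"
  by (auto simp: polys_upto_def monoms_upto_def in_poly_ring_iff)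

lemma polys_upto_mono: "d \<le> d' \<Longrightarrow> polys_upto X d \<subseteq> polys_upto X d'"
  by (auto simp: polys_upto_def monoms_upto_def)

lemma one_in_polys_upto: "1 \<in> polys_upto X d"
  by (simp add: polys_upto_def monoms_upto_def)

lemma polys_upto_mult:
  assumes "p \<in> polys_upto X d" "q \<in> polys_upto X d'"
  shows "p * q \<in> polys_upto X (d + d')"
  unfolding polys_upto_def
proof clarify
  fix m assume "m \<in> keys (p * q)"
  then obtain u v where uv: "m = u + v" "u \<in> keys p" "v \<in> keys q"
    using keys_mult[of p q] by blast
  then have "u \<in> monoms_upto X d" "v \<in> monoms_upto X d'"
    using assms by (auto simp: polys_upto_def)
  then show "m \<in> monoms_upto X (d + d')"
    unfolding uv(1) by (simp add: monoms_upto_def keys_add_nat monom_degree_add)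
qed

lemma polys_upto_power:
  assumes "p \<in> polys_upto X d"
  shows "p ^ i \<in> polys_upto X (d * i)"
  by (induction i) (use one_in_polys_upto polys_upto_mult[OF assms] in auto)

lemma ex_polys_upto:
  assumes "p \<in> carrier (poly_ring X)"
  shows "\<exists>d. p \<in> polys_upto X d"
proof (intro exI)
  have "monom_degree m \<le> (\<Sum>m\<in>keys p. monom_degree m)" if "m \<in> keys p" for m
    using that by (intro member_le_sum) auto
  then show "p \<in> polys_upto X (\<Sum>m\<in>keys p. monom_degree m)"
    using assms by (auto simp: polys_upto_def monoms_upto_def in_poly_ring_iff)
qed

lemma lookup_const_mult: "lookup (const c * p :: ('x, 'k::field) mpoly) m = c * lookup p m"
proof -
  have "const c * p = (\<Sum>m\<in>keys p. single m (c * lookup p m))"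
    by (subst (1) mpoly_expand[of p]) (simp add: sum_distrib_left const_def mult_single)
  then show ?thesis
    by (simp add: lookup_sum lookup_single when_def in_keys_iff)
qed

lemma poly_ideal_diff:
  assumes "ideal P (poly_ring X)" "p \<in> P" "q \<in> P"
  shows "p - q \<in> P"
proof -
  note sub = ideal.axioms(1)[OF assms(1)]
  have "q \<in> carrier (poly_ring X)" by (rule ideal.Icarr[OF assms(1,3)])
  then have "- q \<in> P"
    using additive_subgroup.a_inv_closed[OF sub assms(3)] by (simp add: poly_ring_a_inv)
  then have "p + - q \<in> P"
    using additive_subgroup.a_closed[OF sub assms(2)] unfolding poly_ring_ops by blast
  then show ?thesis by simp
qed

lemma poly_ideal_mult:
  assumes "ideal P (poly_ring X)" "p \<in> P" "q \<in> carrier (poly_ring X)"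
  shows "p * q \<in> P"
  using ideal.I_r_closed[OF assms] by (simp add: poly_ring_ops)

text \<open>Modulo \<open>Q\<close> only the constant term \<open>G 0\<close> is left, so it lies in \<open>Q\<close> and vanishes by assumption. As
  \<open>f\<close> is not in the prime \<open>P\<close>, the remaining terms can be divided by \<open>f\<close>, and the argument
  repeats.\<close>

lemma power_combination_in_ideal:
  fixes P Q :: "('x, 'k::field) mpoly set"
  assumes "primeideal P (poly_ring X)" "ideal Q (poly_ring X)" "P \<subseteq> Q" "f \<in> Q" "f \<notin> P"
    and "\<And>i. G i \<in> carrier (poly_ring X)" "\<And>i. G i \<in> Q \<Longrightarrow> G i = 0"
    and "(\<Sum>i\<le>D. f ^ i * G i) \<in> P"
  shows "\<forall>i\<le>D. G i = 0"
  using assms(6-8)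
proof (induction D arbitrary: G)
  case 0
  then show ?case using assms(3) by auto
next
  case (Suc D)
  interpret P: primeideal P "poly_ring X" by (rule assms(1))
  interpret Q: ideal Q "poly_ring X" by (rule assms(2))
  let ?S = "\<Sum>i\<le>D. f ^ i * G (Suc i)"
  have f: "f \<in> carrier (poly_ring X)" using assms(4) by (rule Q.Icarr)
  have pow: "f ^ i \<in> carrier (poly_ring X)" for i
    by (induction i) (simp_all add: poly_ring_mult_closed f, simp add: in_poly_ring_iff)
  have S: "?S \<in> carrier (poly_ring X)"
    by (intro poly_ring_sum_closed poly_ring_mult_closed pow Suc.prems)
  have split: "(\<Sum>i\<le>Suc D. f ^ i * G i) = G 0 + f * ?S"
    by (subst sum.atMost_Suc_shift) (simp add: sum_distrib_left mult.assoc)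
  have "(G 0 + f * ?S) - f * ?S \<in> Q"
    by (rule poly_ideal_diff[OF assms(2)])
      (use Suc.prems(3) split assms(3) poly_ideal_mult[OF assms(2) assms(4) S] in auto)
  then have G0: "G 0 = 0" using Suc.prems(2) by simp
  then have "f * ?S \<in> P" using Suc.prems(3) split by simp
  then have "?S \<in> P" using P.I_prime[OF f S] assms(5) by (simp add: poly_ring_ops)
  then have "\<forall>i\<le>D. G (Suc i) = 0" using Suc.IH[of "\<lambda>i. G (Suc i)"] Suc.prems by blast
  then show ?case using G0 by (metis Suc_le_mono not0_implies_Suc)
qed

text \<open>Elements \<open>f\<close> taken from the successive differences of the chain are algebraically independent modulo
  its first prime. The family \<open>g\<close> lists their monomials with all exponents at most \<open>D\<close>, indexed by lists
  of exponents; \<open>s\<close> bounds the sum of the degrees of the chosen elements.\<close>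

lemma prime_chain_independent:
  fixes Q :: "nat \<Rightarrow> ('x, 'k::field) mpoly set"
  assumes "\<And>i. i \<le> n \<Longrightarrow> primeideal (Q i) (poly_ring X)" "\<And>i. i < n \<Longrightarrow> Q i \<subset> Q (Suc i)"
  shows "\<exists>s. \<forall>D. \<exists>(J :: nat list set) g. finite J \<and> card J = (D + 1) ^ n \<and>
    (\<forall>j\<in>J. g j \<in> polys_upto X (s * D)) \<and>
    (\<forall>c. (\<Sum>j\<in>J. const (c j) * g j) \<in> Q 0 \<longrightarrow> (\<forall>j\<in>J. c j = 0))"
  using assms
proof (induction n arbitrary: Q)
  case 0
  interpret Q: primeideal "Q 0" "poly_ring X" using 0 by simp
  have "c = 0" if c: "const c \<in> Q 0" for c :: 'k
  proof (rule ccontr)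
    assume "c \<noteq> 0"
    have "const c * const (inverse c) = (const (c * inverse c) :: ('x, 'k) mpoly)"
      by (simp only: const_mult)
    then have "const c * const (inverse c) = (1 :: ('x, 'k) mpoly)"
      using \<open>c \<noteq> 0\<close> by (simp add: const_def)
    then have "1 \<in> Q 0"
      using poly_ideal_mult[OF Q.is_ideal c const_in_poly_ring] by metis
    then have "carrier (poly_ring X) = Q 0"
      using Q.one_imp_carrier by (simp add: poly_ring_ops)
    then show False using Q.I_notcarr by simp
  qed
  then show ?case
    by (intro exI[of _ 0] allI exI[of _ "{[]}"] exI[of _ "\<lambda>_. 1"]) (simp add: one_in_polys_upto)
next
  case (Suc n)
  obtain s where s: "\<And>D. \<exists>(J :: nat list set) g. finite J \<and> card J = (D + 1) ^ n \<and>
    (\<forall>j\<in>J. g j \<in> polys_upto X (s * D)) \<and>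
    (\<forall>c. (\<Sum>j\<in>J. const (c j) * g j) \<in> Q (Suc 0) \<longrightarrow> (\<forall>j\<in>J. c j = 0))"
    using Suc.IH[of "\<lambda>i. Q (Suc i)"] Suc.prems by auto
  obtain f where f: "f \<in> Q (Suc 0)" "f \<notin> Q 0" using Suc.prems(2)[of 0] by blast
  interpret Q1: primeideal "Q (Suc 0)" "poly_ring X" using Suc.prems(1) by simp
  obtain s' where s': "f \<in> polys_upto X s'" using ex_polys_upto[OF Q1.Icarr[OF f(1)]] by blast
  show ?case
  proof (intro exI[of _ "s' + s"] allI)
    fix D
    obtain J :: "nat list set" and g where J: "finite J" "card J = (D + 1) ^ n"
      "\<And>j. j \<in> J \<Longrightarrow> g j \<in> polys_upto X (s * D)"
      "\<And>c. (\<Sum>j\<in>J. const (c j) * g j) \<in> Q (Suc 0) \<Longrightarrow> \<forall>j\<in>J. c j = 0"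
      using s[of D] by blast
    define J' where "J' = (\<lambda>(i, xs). i # xs) ` ({..D} \<times> J)"
    define g' where "g' xs = f ^ hd xs * g (tl xs)" for xs
    have inj: "inj_on (\<lambda>(i, xs). i # xs) ({..D} \<times> J)" by (auto simp: inj_on_def)
    have card: "card J' = (D + 1) ^ Suc n"
      unfolding J'_def card_image[OF inj] by (simp add: card_cartesian_product J(2))
    have deg: "g' j \<in> polys_upto X ((s' + s) * D)" if "j \<in> J'" for j
    proof -
      obtain i xs where j: "j = i # xs" "i \<le> D" "xs \<in> J" using \<open>j \<in> J'\<close> by (auto simp: J'_def)
      have "f ^ i * g xs \<in> polys_upto X (s' * i + s * D)"
        by (intro polys_upto_mult polys_upto_power s' J(3) j)
      moreover have "s' * i + s * D \<le> (s' + s) * D" using j(2) by (simp add: add_mult_distrib)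
      ultimately show ?thesis using polys_upto_mono j(1) by (fastforce simp: g'_def)
    qed
    have "\<forall>j\<in>J'. c j = 0" if c: "(\<Sum>j\<in>J'. const (c j) * g' j) \<in> Q 0" for c
    proof -
      \<comment> \<open>The coefficient of \<open>f ^ i\<close>; it is defined as zero for \<open>i > D\<close>, so that \<open>G i \<in> Q (Suc 0)\<close> forces \<open>G i = 0\<close> for all \<open>i\<close>.\<close>
      define G where "G i = (\<Sum>xs\<in>J. const (if i \<le> D then c (i # xs) else 0) * g xs)" for i
      have vanish: "\<forall>xs\<in>J. i \<le> D \<longrightarrow> c (i # xs) = 0" if "G i \<in> Q (Suc 0)" for i
        using J(4)[OF that[unfolded G_def]] by auto
      have "\<forall>i\<le>D. G i = 0"
      proof (rule power_combination_in_ideal[of "Q 0" X "Q (Suc 0)" f])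
        show "primeideal (Q 0) (poly_ring X)" using Suc.prems(1) by simp
        show "ideal (Q (Suc 0)) (poly_ring X)" by (rule Q1.is_ideal)
        show "Q 0 \<subseteq> Q (Suc 0)" using Suc.prems(2)[of 0] by blast
        show "f \<in> Q (Suc 0)" "f \<notin> Q 0" by (rule f)+
        show "G i \<in> carrier (poly_ring X)" for i
          unfolding G_def
          by (intro poly_ring_sum_closed poly_ring_mult_closed const_in_poly_ring)
            (rule polys_upto_carrier[OF J(3)])
        show "G i = 0" if "G i \<in> Q (Suc 0)" for i
          using vanish[OF that] unfolding G_def by (intro sum.neutral) (auto simp: const_def)
        have "(\<Sum>j\<in>J'. const (c j) * g' j) = (\<Sum>(i, xs)\<in>{..D} \<times> J. const (c (i # xs)) * (f ^ i * g xs))"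
          unfolding J'_def sum.reindex[OF inj] by (rule sum.cong) (auto simp: g'_def)
        also have "\<dots> = (\<Sum>i\<le>D. \<Sum>xs\<in>J. const (c (i # xs)) * (f ^ i * g xs))"
          by (simp add: sum.cartesian_product)
        also have "\<dots> = (\<Sum>i\<le>D. f ^ i * G i)"
          unfolding G_def sum_distrib_left by (intro sum.cong refl) (auto simp: ac_simps)
        finally show "(\<Sum>i\<le>D. f ^ i * G i) \<in> Q 0" using c by simp
      qed
      then have "G i \<in> Q (Suc 0)" if "i \<le> D" for i
        using that additive_subgroup.zero_closed[OF ideal.axioms(1)[OF Q1.is_ideal]]
        by (simp add: poly_ring_ops)
      then show ?thesis using vanish by (auto simp: J'_def)
    qed
    then show "\<exists>(J :: nat list set) g. finite J \<and> card J = (D + 1) ^ Suc n \<and>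
        (\<forall>j\<in>J. g j \<in> polys_upto X ((s' + s) * D)) \<and>
        (\<forall>c. (\<Sum>j\<in>J. const (c j) * g j) \<in> Q 0 \<longrightarrow> (\<forall>j\<in>J. c j = 0))"
      using card deg J(1) by (intro exI[of _ J'] exI[of _ g']) (auto simp: J'_def)
  qed
qed

text \<open>The independent family of \<open>(D + 1)\<^sup>n\<close> elements lives in degree at most \<open>s * D\<close>, where the image has
  dimension at most \<open>C (s * D + 1)\<^sup>e\<close>. If \<open>n\<close> exceeded \<open>e\<close>, linear algebra would give a relation for
  large \<open>D\<close>.\<close>

lemma toric_prime_chain_length_le:
  fixes Q :: "nat \<Rightarrow> ('x, 'k::field) mpoly set" and a :: "'x \<Rightarrow> ('y \<Rightarrow>\<^sub>0 nat)"
  assumes "finite X" "\<And>i. i \<le> n \<Longrightarrow> primeideal (Q i) (poly_ring X)"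
    "\<And>i. i < n \<Longrightarrow> Q i \<subset> Q (Suc i)" "toric_kernel X a \<subseteq> Q 0"
    "\<And>d. card (expo a ` monoms_upto X d) \<le> C * (d + 1) ^ e"
  shows "n \<le> e"
proof (rule ccontr)
  assume "\<not> n \<le> e"
  obtain s where s: "\<And>D. \<exists>(J :: nat list set) g. finite J \<and> card J = (D + 1) ^ n \<and>
    (\<forall>j\<in>J. g j \<in> polys_upto X (s * D)) \<and>
    (\<forall>c. (\<Sum>j\<in>J. const (c j) * g j) \<in> Q 0 \<longrightarrow> (\<forall>j\<in>J. c j = 0))"
    using prime_chain_independent[of n Q X, OF assms(2,3)] by blast
  \<comment> \<open>With this choice \<open>C * (s * D + 1) ^ e\<close> is at most \<open>D * (D + 1) ^ e\<close>, which is below \<open>(D + 1) ^ Suc e\<close>.\<close>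
  define D where "D = C * (s + 1) ^ e"
  obtain J :: "nat list set" and g where J: "finite J" "card J = (D + 1) ^ n"
    "\<And>j. j \<in> J \<Longrightarrow> g j \<in> polys_upto X (s * D)"
    "\<And>c. (\<Sum>j\<in>J. const (c j) * g j) \<in> Q 0 \<Longrightarrow> \<forall>j\<in>J. c j = 0"
    using s[of D] by blast
  let ?T = "expo a ` monoms_upto X (s * D)"
  have "card J \<le> card ?T"
  proof (rule ccontr)
    assume "\<not> card J \<le> card ?T"
    then obtain c where c: "\<exists>j\<in>J. c j \<noteq> 0"
      "\<And>t. t \<in> ?T \<Longrightarrow> (\<Sum>j\<in>J. c j * lookup (monomial_map a (g j)) t) = 0"
      using underdetermined_system[of ?T J "\<lambda>j. lookup (monomial_map a (g j))"] J(1)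
        finite_monoms_upto[OF assms(1)] by auto
    let ?p = "\<Sum>j\<in>J. const (c j) * g j"
    have map: "lookup (monomial_map a ?p) t = (\<Sum>j\<in>J. c j * lookup (monomial_map a (g j)) t)" for t
      by (simp add: monomial_map_sum monomial_map_mult lookup_sum lookup_const_mult)
    have "lookup (monomial_map a ?p) t = 0" for t
    proof (cases "t \<in> ?T")
      case True then show ?thesis using c(2) map by simp
    next
      case False
      have "lookup (monomial_map a (g j)) t = 0" if "j \<in> J" for j
      proof -
        have none: "{m \<in> keys (g j). expo a m = t} = {}" using J(3)[OF that] False by (auto simp: polys_upto_def)
        show ?thesis unfolding lookup_monomial_map none by simp
      qed
      then show ?thesis by (simp add: map)
    qed
    moreover have "?p \<in> carrier (poly_ring X)"
      by (intro poly_ring_sum_closed poly_ring_mult_closed const_in_poly_ring)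
        (rule polys_upto_carrier[OF J(3)])
    ultimately have "?p \<in> Q 0"
      using assms(4) by (auto simp: toric_kernel_def intro!: poly_mapping_eqI)
    then show False using J(4) c(1) by blast
  qed
  also have "card ?T \<le> C * (s * D + 1) ^ e" by (rule assms(5))
  also have "\<dots> \<le> C * ((s + 1) * (D + 1)) ^ e" by (intro mult_left_mono power_mono) auto
  also have "\<dots> = D * (D + 1) ^ e" unfolding D_def by (simp only: power_mult_distrib mult.assoc)
  finally have "(D + 1) ^ n \<le> D * (D + 1) ^ e" using J(2) by simp
  also have "\<dots> < (D + 1) ^ Suc e" by simp
  finally have "(D + 1) ^ n < (D + 1) ^ Suc e" .
  moreover have "(D + 1) ^ Suc e \<le> (D + 1) ^ n"
    using \<open>\<not> n \<le> e\<close> by (intro power_increasing) auto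
  ultimately show False by simp
qed

section \<open>The pole at 1 of the Hilbert series of a toric ring\<close>

text \<open>The order \<open>e\<close> of the pole at \<open>1\<close> is the growth exponent of the number of exponent vectors of degree at
  most \<open>d\<close>, and the two estimates for chains of primes bound the Krull dimension by \<open>e\<close> from both sides.
  The cumulative count is used because the ideals in a chain need not be homogeneous; its series is
  the Hilbert series divided by \<open>1 - t\<close>.\<close>

theorem hilbert_series_toric_kernel:
  fixes a :: "'x \<Rightarrow> ('y \<Rightarrow>\<^sub>0 nat)"
  assumes "finite X" "\<And>x. x \<in> X \<Longrightarrow> monom_degree (a x) = w" "w > 0"
  defines "I \<equiv> toric_kernel X a :: ('x, 'k::field) mpoly set"
  shows "\<exists>k. hilbert_series X I * (1 - fps_X) ^ the_enat (krull_dim (poly_ring X Quot I)) = fps_of_poly k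
    \<and> poly k 1 > 0"
proof -
  let ?h = "\<lambda>d. card (expo a ` monoms X d)"
  let ?g = "\<lambda>d. card (expo a ` monoms_upto X d)"
  define F where "F = Abs_fps (\<lambda>d. int (?h d))"
  define G where "G = Abs_fps (\<lambda>d. int (?g d))"
  have H: "hilbert_series X I = F"
    by (simp add: hilbert_series_def F_def I_def hilbert_function_toric_kernel[OF assms(1)])
  have "monoms X 0 = {0}" by (auto simp: monoms_def monom_degree_eq_0_iff)
  then have F0: "fps_nth F 0 > 0" by (simp add: F_def)
  obtain q where q: "F * (1 - fps_X) ^ card X = fps_of_poly q"
    using card_image_monoms_rational[of X a w, OF assms(1-3)] unfolding F_def by blast
  then obtain e k where k: "F * (1 - fps_X) ^ e = fps_of_poly k" "poly k 1 \<noteq> 0"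
    using rational_minimal_denominator[OF q _ F0] by (force simp: F_def)
  have cumul: "?g d = (\<Sum>i\<le>d. ?h i)" for d
  proof -
    have "expo a ` monoms_upto X d = (\<Union>i\<le>d. expo a ` monoms X i)"
      by (auto simp: monoms_upto_def monoms_def)
    moreover have "expo a ` monoms X i \<inter> expo a ` monoms X j = {}" if "i \<noteq> j" for i j
    proof -
      have "monom_degree t = i * w" if "t \<in> expo a ` monoms X i" for t i
        using that monom_degree_expo[of X a w, OF assms(2)] by (auto simp: monoms_def)
      then show ?thesis using that assms(3) by (metis disjoint_iff mult_cancel2 less_irrefl)
    qed
    ultimately show ?thesis
      using finite_monoms[OF assms(1)] by (simp add: card_UN_disjoint)
  qed
  have "G * (1 - fps_X) = F"
  proof (rule fps_ext)
    fix d
    show "fps_nth (G * (1 - fps_X)) d = fps_nth F d"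
      by (cases d) (simp_all add: right_diff_distrib F_def G_def cumul)
  qed
  then have G: "G * (1 - fps_X) ^ Suc e = fps_of_poly k"
    using k(1) by (simp add: mult.assoc[symmetric])
  have pos: "poly k 1 > 0"
    by (rule rational_coeff_growth(1)[OF G k(2)]) (simp add: G_def)
  obtain n0 where n0: "\<And>n. n \<ge> n0 \<Longrightarrow> int (n + 1) ^ e \<le> 2 * fact e * fps_nth G n"
    using rational_coeff_growth(2)[OF G k(2)] by (auto simp: G_def)
  have lower: "(d + 1) ^ e \<le> 2 * fact e * ?g d" if "d \<ge> n0" for d
  proof -
    have "int ((d + 1) ^ e) \<le> int (2 * fact e * ?g d)"
      using n0[OF that]
      by (simp add: G_def algebra_simps)
    then show ?thesis by (simp only: of_nat_le_iff)
  qed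
  obtain C where C: "C \<ge> 0" "\<And>n. \<bar>fps_nth G n\<bar> \<le> C * int (n + 1) ^ e"
    using rational_coeff_bound[OF G] by blast
  have upper: "?g d \<le> nat C * (d + 1) ^ e" for d
  proof -
    have "int (?g d) \<le> int (nat C * (d + 1) ^ e)"
      using C(2)[of d] C(1) by (simp add: G_def algebra_simps)
    then show ?thesis by (simp only: of_nat_le_iff)
  qed
  have "krull_dim (poly_ring X Quot I) \<le> enat e"
  proof (rule krull_dim_quot_le[OF cring_poly_ring])
    show "ideal I (poly_ring X)" unfolding I_def by (rule ideal_toric_kernel)
    fix n and Q :: "nat \<Rightarrow> ('x, 'k) mpoly set"
    assume "\<And>i. i \<le> n \<Longrightarrow> primeideal (Q i) (poly_ring X)" "\<And>i. i < n \<Longrightarrow> Q i \<subset> Q (Suc i)" "I \<subseteq> Q 0"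
    then show "n \<le> e"
      using toric_prime_chain_length_le[of X n Q a "nat C" e] assms(1) upper unfolding I_def by blast
  qed
  moreover have "enat e \<le> krull_dim (poly_ring X Quot I)"
  proof -
    define Y where "Y = (\<Union>x\<in>X. keys (a x))"
    have finY: "finite Y" using assms(1) by (simp add: Y_def)
    have bound: "lookup (a x) y \<le> w" if "x \<in> X" for x y
      using lookup_le_monom_degree[of "a x" y] assms(2)[OF that] by simp
    obtain n and P :: "nat \<Rightarrow> ('x, 'k) mpoly set" where
      P: "\<And>i. i \<le> n \<Longrightarrow> primeideal (P i) (poly_ring X)" "\<And>i. i < n \<Longrightarrow> P i \<subset> P (Suc i)"
        "toric_kernel X (restrict_coords Y a) \<subseteq> P 0" and
      card: "\<And>d. card (expo (restrict_coords Y a) ` monoms_upto X d) \<le> (w * d + 1) ^ n"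
      using toric_prime_chain[OF assms(1) finY, of a w] bound by blast
    have restr: "expo (restrict_coords Y a) m = expo a m" if "keys m \<subseteq> X" for m
    proof (rule poly_mapping_eqI)
      fix y
      have "lookup (expo a m) y = 0" if "y \<notin> Y"
        unfolding lookup_expo using that \<open>keys m \<subseteq> X\<close>
        by (intro sum.neutral) (auto simp: Y_def in_keys_iff)
      then show "lookup (expo (restrict_coords Y a) m) y = lookup (expo a m) y"
        by (simp add: lookup_expo_restrict_coords[OF finY])
    qed
    have "I \<subseteq> toric_kernel X (restrict_coords Y a)"
      unfolding I_def by (rule toric_kernel_mono) (simp add: restr)
    then have "enat n \<le> krull_dim (poly_ring X Quot I)"
      using P by (intro krull_dim_quot_ge[where P = P] cring_poly_ring)
        (auto simp: I_def ideal_toric_kernel)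
    moreover have "e \<le> n"
    proof (rule ccontr)
      assume "\<not> e \<le> n"
      \<comment> \<open>Beyond \<open>D\<close> growth with exponent \<open>e\<close> contradicts the bound with a smaller exponent \<open>n\<close>.\<close>
      define D where "D = 2 * fact e * (w + 1) ^ n"
      define d where "d = max n0 D"
      have "expo (restrict_coords Y a) ` monoms_upto X d = expo a ` monoms_upto X d"
        by (rule image_cong) (auto simp: monoms_upto_def restr)
      then have "?g d \<le> (w * d + 1) ^ n" using card[of d] by simp
      also have "\<dots> \<le> ((w + 1) * (d + 1)) ^ n" by (rule power_mono) auto
      finally have "2 * fact e * ?g d \<le> D * (d + 1) ^ n"
        unfolding D_def power_mult_distrib mult.assoc by (intro mult_left_mono) auto
      moreover have "(d + 1) ^ Suc n \<le> (d + 1) ^ e"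
        using \<open>\<not> e \<le> n\<close> by (intro power_increasing) auto
      moreover have "D * (d + 1) ^ n < (d + 1) ^ Suc n"
        unfolding power_Suc by (intro mult_strict_right_mono) (auto simp: d_def)
      moreover have "(d + 1) ^ e \<le> 2 * fact e * ?g d" by (rule lower) (simp add: d_def)
      ultimately show False by linarith
    qed
    ultimately show ?thesis by (meson enat_ord_simps(1) order_trans)
  qed
  ultimately have "krull_dim (poly_ring X Quot I) = enat e" by (rule antisym)
  then show ?thesis using k(1) pos H by auto
qed

text \<open>The numerator is determined by its defining equation, hence so is its value at \<open>1\<close>.\<close>

lemma ideal_degree_eqI:
  assumes "hilbert_series X I * (1 - fps_X) ^ the_enat (krull_dim (poly_ring X Quot I)) = fps_of_poly k"
    "poly k 1 > 0"
  shows "ideal_degree X I = poly k 1"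
  unfolding ideal_degree_def
proof (rule the_equality)
  show "\<exists>k'. hilbert_series X I * (1 - fps_X) ^ the_enat (krull_dim (poly_ring X Quot I)) = fps_of_poly k' \<and>
      poly k' 1 > 0 \<and> poly k 1 = poly k' 1"
    using assms by blast
  fix c assume "\<exists>k'. hilbert_series X I * (1 - fps_X) ^ the_enat (krull_dim (poly_ring X Quot I)) = fps_of_poly k' \<and>
      poly k' 1 > 0 \<and> c = poly k' 1"
  then show "c = poly k 1" using assms(1) by (auto simp: fps_of_poly_eq_iff)
qed

section \<open>Monomial maps on disjoint sets of variables\<close>

lemma expo_cong: "(\<And>x. x \<in> keys m \<Longrightarrow> a x = b x) \<Longrightarrow> expo a m = expo b m"
  by (simp add: expo_def)

lemma expo_sum: "expo b (\<Sum>i\<in>I. u i) = (\<Sum>i\<in>I. expo b (u i))"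
  by (induction I rule: infinite_finite_induct) (simp_all add: expo_add)

lemma expo_expo: "expo b (expo a m) = expo (\<lambda>x. expo b (a x)) m"
  by (simp only: expo_def[of a m] expo_def[of "\<lambda>x. expo b (a x)" m] expo_sum)

lemma relabel_id: "relabel (\<lambda>x. x) m = m"
proof (rule poly_mapping_eqI)
  fix x
  show "lookup (relabel (\<lambda>x. x) m) x = lookup m x"
    using lookup_relabel[of "\<lambda>x. x" "insert x (keys m)" m x] by (simp add: subset_insertI)
qed

lemma keys_expo_subset: "keys (expo a m) \<subseteq> (\<Union>x\<in>keys m. keys (a x))"
proof
  fix y assume y: "y \<in> keys (expo a m)"
  show "y \<in> (\<Union>x\<in>keys m. keys (a x))"
  proof (rule ccontr)
    assume "y \<notin> (\<Union>x\<in>keys m. keys (a x))"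
    then have "lookup (expo a m) y = 0"
      unfolding lookup_expo by (intro sum.neutral) (auto simp: in_keys_iff)
    then show False using y by (simp add: in_keys_iff)
  qed
qed

lemma keys_relabel_subset: "keys (relabel g m) \<subseteq> g ` keys m"
  by (rule order_trans[OF keys_expo_subset]) auto

text \<open>The inverse of \<open>relabel g\<close> on these monomials is relabelling by the inverse of \<open>g\<close>.\<close>

lemma relabel_monoms:
  assumes "inj_on g X"
  shows "relabel g ` monoms X d = monoms (g ` X) d"
proof (intro equalityI subsetI)
  have deg: "monom_degree (relabel f m) = monom_degree m" for f :: "'u \<Rightarrow> 'v" and m
    using monom_degree_expo[of UNIV "\<lambda>y. single (f y) (Suc 0)" 1 m] by simp
  show "m' \<in> monoms (g ` X) d" if "m' \<in> relabel g ` monoms X d" for m'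
    using that keys_relabel_subset[of g] by (fastforce simp: monoms_def deg)
  fix m' assume m': "m' \<in> monoms (g ` X) d"
  let ?m = "relabel (inv_into X g) m'"
  have "keys ?m \<subseteq> X"
  proof -
    have "keys ?m \<subseteq> inv_into X g ` keys m'" by (rule keys_relabel_subset)
    also have "\<dots> \<subseteq> inv_into X g ` g ` X" using m' by (intro image_mono) (simp add: monoms_def)
    also have "\<dots> = X" by (rule inv_into_image_cancel[OF assms order_refl])
    finally show ?thesis .
  qed
  moreover have "relabel g ?m = m'"
  proof -
    have "relabel g ?m = relabel (\<lambda>x. g (inv_into X g x)) m'" by (simp add: expo_expo)
    also have "\<dots> = relabel (\<lambda>x. x) m'"
      by (rule expo_cong) (use m' in \<open>auto simp: monoms_def f_inv_into_f subset_iff\<close>)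
    finally show ?thesis by (simp only: relabel_id)
  qed
  moreover have "monom_degree ?m = d" using m' by (simp add: deg monoms_def)
  ultimately show "m' \<in> relabel g ` monoms X d" by (force simp: monoms_def)
qed

lemma card_image_monoms_relabel:
  assumes "inj_on g X" "inj_on h Y" "finite Y" "\<And>x. x \<in> X \<Longrightarrow> keys (a x) \<subseteq> Y"
    "\<And>x. x \<in> X \<Longrightarrow> b (g x) = relabel h (a x)"
  shows "card (expo b ` monoms (g ` X) d) = card (expo a ` monoms X d)"
proof -
  have "expo b (relabel g m) = relabel h (expo a m)" if "m \<in> monoms X d" for m
    unfolding expo_expo by (rule expo_cong) (use that assms(5) in \<open>auto simp: monoms_def\<close>)
  then have "expo b ` monoms (g ` X) d = relabel h ` expo a ` monoms X d"
    unfolding relabel_monoms[OF assms(1), symmetric] image_image by (rule image_cong[OF refl])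
  moreover have "keys (expo a m) \<subseteq> Y" if "m \<in> monoms X d" for m
    using keys_expo_subset[of a m] that assms(4) by (fastforce simp: monoms_def)
  then have "inj_on (relabel h) (expo a ` monoms X d)"
    by (intro inj_on_subset[OF inj_on_relabel[OF assms(2,3)]]) auto
  ultimately show ?thesis by (simp add: card_image)
qed

text \<open>A product of two toric rings: when the variables split into two groups whose images involve disjoint
  sets of target variables, an exponent vector of the image splits uniquely into one for each group.
  The degrees of the two parts are determined by the parts because the map is homogeneous.\<close>

lemma card_image_monoms_disjoint_union:
  fixes a :: "'x \<Rightarrow> ('y \<Rightarrow>\<^sub>0 nat)"
  assumes "finite U" "finite V" "U \<inter> V = {}" "Y \<inter> Z = {}"
    "\<And>x. x \<in> U \<Longrightarrow> keys (a x) \<subseteq> Y" "\<And>x. x \<in> V \<Longrightarrow> keys (a x) \<subseteq> Z"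
    "\<And>x. x \<in> U \<union> V \<Longrightarrow> monom_degree (a x) = w" "w > 0"
  shows "card (expo a ` monoms (U \<union> V) d) =
    (\<Sum>i\<le>d. card (expo a ` monoms U i) * card (expo a ` monoms V (d - i)))"
proof -
  let ?S = "SIGMA i:{..d}. (expo a ` monoms U i) \<times> (expo a ` monoms V (d - i))"
  let ?f = "\<lambda>(i :: nat, s, t). s + t"
  have kU: "keys s \<subseteq> Y" if "s \<in> expo a ` monoms U i" for s i
    using that keys_expo_subset[of a] assms(5) by (fastforce simp: monoms_def)
  have kV: "keys t \<subseteq> Z" if "t \<in> expo a ` monoms V i" for t i
    using that keys_expo_subset[of a] assms(6) by (fastforce simp: monoms_def)
  have deg: "monom_degree s = i * w" if "s \<in> expo a ` monoms U i" for s i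
    using that monom_degree_expo[of U a w] assms(7) by (auto simp: monoms_def)
  have inj: "inj_on ?f ?S"
  proof (rule inj_onI)
    fix p p' assume pp: "p \<in> ?S" "p' \<in> ?S" "?f p = ?f p'"
    obtain i s t where p: "p = (i, s, t)" "s \<in> expo a ` monoms U i" "t \<in> expo a ` monoms V (d - i)"
      using pp(1) by blast
    obtain i' s' t' where p': "p' = (i', s', t')" "s' \<in> expo a ` monoms U i'" "t' \<in> expo a ` monoms V (d - i')"
      using pp(2) by blast
    have eq: "s + t = s' + t'" using pp(3) p(1) p'(1) by simp
    have "lookup s y = lookup s' y" for y
    proof (cases "y \<in> Y")
      case True
      then have "y \<notin> keys t" "y \<notin> keys t'" using kV[OF p(3)] kV[OF p'(3)] assms(4) by auto
      then show ?thesis using arg_cong[OF eq, of "\<lambda>u. lookup u y"] by (simp add: lookup_add in_keys_iff)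
    next
      case False
      then have "y \<notin> keys s" "y \<notin> keys s'" using kU[OF p(2)] kU[OF p'(2)] by auto
      then show ?thesis by (simp add: in_keys_iff)
    qed
    then have s: "s = s'" by (rule poly_mapping_eqI)
    then have "i = i'" using deg[OF p(2)] deg[OF p'(2)] assms(8) by simp
    then show "p = p'" using s eq p(1) p'(1) by simp
  qed
  have img: "?f ` ?S = expo a ` monoms (U \<union> V) d"
  proof (intro equalityI subsetI)
    fix t assume "t \<in> ?f ` ?S"
    then obtain i m n where "i \<le> d" "m \<in> monoms U i" "n \<in> monoms V (d - i)" "t = expo a (m + n)"
      by (auto simp: expo_add)
    then show "t \<in> expo a ` monoms (U \<union> V) d"
      by (intro image_eqI[of _ _ "m + n"]) (auto simp: monoms_def keys_add_nat monom_degree_add)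
  next
    fix t assume "t \<in> expo a ` monoms (U \<union> V) d"
    then obtain m where m: "keys m \<subseteq> U \<union> V" "monom_degree m = d" "t = expo a m"
      by (auto simp: monoms_def)
    define r where "r A = (\<Sum>x\<in>A. single x (lookup m x))" for A
    have lr: "lookup (r A) x = (if x \<in> A then lookup m x else 0)" if "finite A" for A x
      using that by (simp add: r_def lookup_sum lookup_single when_def)
    have sum: "r U + r V = m"
      by (rule poly_mapping_eqI) (use m(1) assms(1-3) in \<open>auto simp: lookup_add lr in_keys_iff\<close>)
    have "keys (r U) \<subseteq> U" "keys (r V) \<subseteq> V"
      using assms(1,2) by (auto simp: in_keys_iff lr split: if_splits)
    moreover have "monom_degree (r U) + monom_degree (r V) = d"
      using m(2) sum by (metis monom_degree_add)
    ultimately have "r U \<in> monoms U (monom_degree (r U))" "r V \<in> monoms V (d - monom_degree (r U))"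
      "monom_degree (r U) \<le> d"
      by (auto simp: monoms_def)
    then have "(monom_degree (r U), expo a (r U), expo a (r V)) \<in> ?S" by auto
    moreover have "t = ?f (monom_degree (r U), expo a (r U), expo a (r V))"
      using m(3) sum by (simp flip: expo_add)
    ultimately show "t \<in> ?f ` ?S" by (rule rev_image_eqI)
  qed
  have "card (expo a ` monoms (U \<union> V) d) = card ?S"
    unfolding img[symmetric] by (rule card_image[OF inj])
  then show ?thesis
    using finite_monoms[OF assms(1)] finite_monoms[OF assms(2)]
    by (simp add: card_cartesian_product)
qed

section \<open>Binary hierarchical models and cones\<close>

text \<open>The exponent vector of the image of the variable \<open>p\<^sub>S\<close>.\<close>

definition model_expo :: "'a set set \<Rightarrow> 'a set \<Rightarrow> ('a set \<times> 'a set \<Rightarrow>\<^sub>0 nat)" where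
  "model_expo \<Delta> S = (\<Sum>F\<in>facets \<Delta>. single (S \<inter> F, F) (Suc 0))"

lemma toric_ideal_eq_toric_kernel:
  "(toric_ideal V \<Delta> :: ('a set, 'k::field) mpoly set) = toric_kernel (Pow V) (model_expo \<Delta>)"
proof -
  have "(model_map \<Delta> :: ('a set, 'k) mpoly \<Rightarrow> _) = monomial_map (model_expo \<Delta>)"
    by (simp add: model_map_def monomial_map_def var_def prod_single model_expo_def)
  then show ?thesis unfolding toric_ideal_def by (simp only: a_kernel_monomial_map)
qed

lemma facets_finite_nonempty:
  assumes "simplicial_complex V \<Delta>"
  shows "finite (facets \<Delta>)" "facets \<Delta> \<noteq> {}" "\<And>F. F \<in> facets \<Delta> \<Longrightarrow> F \<subseteq> V"
proof -
  have sub: "facets \<Delta> \<subseteq> Pow V" using assms by (auto simp: simplicial_complex_def facets_def)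
  then show "finite (facets \<Delta>)"
    using assms by (meson finite_Pow_iff finite_subset simplicial_complex_def)
  obtain G where "G \<in> \<Delta>" using assms unfolding simplicial_complex_def by blast
  then show "facets \<Delta> \<noteq> {}" using face_in_facet[OF assms] by blast
  show "\<And>F. F \<in> facets \<Delta> \<Longrightarrow> F \<subseteq> V" using sub by blast
qed

lemma monom_degree_model_expo: "monom_degree (model_expo \<Delta> S) = card (facets \<Delta>)"
  by (simp add: model_expo_def monom_degree_sum)

lemma keys_model_expo: "keys (model_expo \<Delta> S) \<subseteq> theta_index \<Delta>"
  unfolding model_expo_def by (rule order_trans[OF keys_sum]) (auto simp: theta_index_def)

lemma finite_theta_index:
  assumes "simplicial_complex V \<Delta>"
  shows "finite (theta_index \<Delta>)"
proof (rule finite_subset)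
  show "theta_index \<Delta> \<subseteq> Pow V \<times> facets \<Delta>"
    using facets_finite_nonempty(3)[OF assms] by (auto simp: theta_index_def)
  show "finite (Pow V \<times> facets \<Delta>)"
    using facets_finite_nonempty(1)[OF assms] assms by (simp add: simplicial_complex_def)
qed

text \<open>The parameters of the cone come in two disjoint copies of the parameters of \<open>\<Delta>\<close>: those indexed by
  sets \<open>H\<close> without the apex \<open>l\<close> and those with it. Subsets of \<open>V\<close> without the apex use the first copy
  and subsets with it the second.\<close>

lemma model_expo_cone:
  assumes "simplicial_complex V \<Delta>" "l \<notin> V" "S \<subseteq> V"
  shows "model_expo (cone l \<Delta>) S = relabel (\<lambda>(H, F). (H, insert l F)) (model_expo \<Delta> S)"
    and "model_expo (cone l \<Delta>) (insert l S) = relabel (\<lambda>(H, F). (insert l H, insert l F)) (model_expo \<Delta> S)"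
proof -
  have l: "l \<notin> F" if "F \<in> facets \<Delta>" for F
    using that assms(2) facets_finite_nonempty(3)[OF assms(1)] by blast
  have inj: "inj_on (insert l) (facets \<Delta>)"
    using l by (intro inj_onI) (metis insert_ident)
  have *: "model_expo (cone l \<Delta>) T = (\<Sum>F\<in>facets \<Delta>. single (T \<inter> insert l F, insert l F) (Suc 0))" for T
    unfolding model_expo_def facets_cone[OF assms(1,2)] by (simp add: sum.reindex[OF inj])
  show "model_expo (cone l \<Delta>) S = relabel (\<lambda>(H, F). (H, insert l F)) (model_expo \<Delta> S)"
    unfolding * model_expo_def[of \<Delta>] expo_sum expo_single_one
    by (rule sum.cong) (use assms(2,3) in \<open>auto simp: Int_insert_right\<close>)
  show "model_expo (cone l \<Delta>) (insert l S) = relabel (\<lambda>(H, F). (insert l H, insert l F)) (model_expo \<Delta> S)"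
    unfolding * model_expo_def[of \<Delta>] expo_sum expo_single_one
    by (rule sum.cong) (use l in \<open>auto simp: Int_insert_left Int_insert_right\<close>)
qed

text \<open>The toric ring of the cone is the tensor product of two copies of the toric ring of \<open>\<Delta>\<close>, one for the
  subsets that avoid the apex and one for those that contain it.\<close>

lemma hilbert_function_cone:
  fixes \<Delta> :: "'a set set"
  assumes "simplicial_complex V \<Delta>" "l \<notin> V"
  shows "hilbert_function (Pow (insert l V)) (toric_ideal (insert l V) (cone l \<Delta>) :: ('a set, 'k::field) mpoly set) d =
    (\<Sum>i\<le>d. hilbert_function (Pow V) (toric_ideal V \<Delta> :: ('a set, 'k) mpoly set) i *
             hilbert_function (Pow V) (toric_ideal V \<Delta> :: ('a set, 'k) mpoly set) (d - i))"
proof -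
  let ?a = "model_expo \<Delta>" and ?b = "model_expo (cone l \<Delta>)"
  let ?g = "\<lambda>(H, F). (H, insert l F)" and ?h = "\<lambda>(H, F). (insert l H, insert l F)"
  have finV: "finite V" using assms(1) by (simp add: simplicial_complex_def)
  note fac = facets_finite_nonempty[OF assms(1)]
  have l: "l \<notin> H" "l \<notin> F" if "(H, F) \<in> theta_index \<Delta>" for H F
    using that assms(2) fac(3) by (auto simp: theta_index_def)
  have ins: "A = B" if "insert l A = insert l B" "l \<notin> A" "l \<notin> B" for A B
    using that by (metis insert_ident)
  have inj: "inj_on ?g (theta_index \<Delta>)" "inj_on ?h (theta_index \<Delta>)"
    unfolding inj_on_def by (clarsimp; metis ins l)+
  have injl: "inj_on (insert l) (Pow V)"
    by (rule inj_onI, rule ins) (use assms(2) in auto)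
  have keys: "keys (?b S) \<subseteq> ?g ` theta_index \<Delta>" "keys (?b (insert l S)) \<subseteq> ?h ` theta_index \<Delta>"
    if "S \<subseteq> V" for S
    unfolding model_expo_cone[OF assms that]
    by (rule order_trans[OF keys_relabel_subset image_mono[OF keys_model_expo]])+
  have V1: "card (expo ?b ` monoms (Pow V) i) = card (expo ?a ` monoms (Pow V) i)" for i
  proof -
    have "card (expo ?b ` monoms ((\<lambda>S. S) ` Pow V) i) = card (expo ?a ` monoms (Pow V) i)"
      by (rule card_image_monoms_relabel[OF _ inj(1) finite_theta_index[OF assms(1)] keys_model_expo])
        (simp_all add: model_expo_cone(1)[OF assms])
    then show ?thesis by simp
  qed
  have V2: "card (expo ?b ` monoms (insert l ` Pow V) i) = card (expo ?a ` monoms (Pow V) i)" for i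
    by (rule card_image_monoms_relabel[OF injl inj(2) finite_theta_index[OF assms(1)] keys_model_expo])
      (simp add: model_expo_cone(2)[OF assms])
  have "card (expo ?b ` monoms (Pow V \<union> insert l ` Pow V) d) =
      (\<Sum>i\<le>d. card (expo ?b ` monoms (Pow V) i) * card (expo ?b ` monoms (insert l ` Pow V) (d - i)))"
  proof (rule card_image_monoms_disjoint_union)
    show "finite (Pow V)" "finite (insert l ` Pow V)" using finV by simp_all
    show "Pow V \<inter> insert l ` Pow V = {}" using assms(2) by auto
    show "?g ` theta_index \<Delta> \<inter> ?h ` theta_index \<Delta> = {}" using l by auto
    show "keys (?b S) \<subseteq> ?g ` theta_index \<Delta>" if "S \<in> Pow V" for S
      using that by (intro keys) simp
    show "keys (?b S) \<subseteq> ?h ` theta_index \<Delta>" if "S \<in> insert l ` Pow V" for S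
      using that keys(2) by (elim imageE) (simp only: Pow_iff)
    show "monom_degree (?b S) = card (facets (cone l \<Delta>))" for S by (rule monom_degree_model_expo)
    show "card (facets (cone l \<Delta>)) > 0"
      unfolding facets_cone[OF assms] using fac by (simp add: card_gt_0_iff)
  qed
  then show ?thesis
    using finV by (simp add: toric_ideal_eq_toric_kernel hilbert_function_toric_kernel V1 V2 Pow_insert)
qed

lemma hilbert_series_cone:
  fixes \<Delta> :: "'a set set"
  assumes "simplicial_complex V \<Delta>" "l \<notin> V"
  shows "hilbert_series (Pow (insert l V)) (toric_ideal (insert l V) (cone l \<Delta>) :: ('a set, 'k::field) mpoly set) =
    (hilbert_series (Pow V) (toric_ideal V \<Delta> :: ('a set, 'k) mpoly set))\<^sup>2"
  by (rule fps_ext) (simp add: hilbert_series_def hilbert_function_cone[OF assms] power2_eq_square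
      fps_mult_nth atLeast0AtMost)

lemma hilbert_series_toric_ideal:
  assumes "simplicial_complex V \<Delta>"
  defines "I \<equiv> toric_ideal V \<Delta> :: ('a set, 'k::field) mpoly set"
  shows "\<exists>k. hilbert_series (Pow V) I * (1 - fps_X) ^ the_enat (krull_dim (poly_ring (Pow V) Quot I)) =
      fps_of_poly k \<and> poly k 1 > 0"
  unfolding I_def toric_ideal_eq_toric_kernel
proof (rule hilbert_series_toric_kernel)
  show "finite (Pow V)" using assms by (simp add: simplicial_complex_def)
  show "monom_degree (model_expo \<Delta> S) = card (facets \<Delta>)" for S by (rule monom_degree_model_expo)
  show "card (facets \<Delta>) > 0" using facets_finite_nonempty[OF assms(1)] by (simp add: card_gt_0_iff)
qed

text \<open>Two expressions of one rational function with numerators that do not vanish at \<open>1\<close> have the same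
  exponent of \<open>1 - t\<close>, the order of the pole, and then the same numerator. For the cone this shows that
  the Krull dimension doubles, without comparing prime ideals of the two rings.\<close>

lemma rational_square_value:
  fixes F :: "int fps"
  assumes "F * (1 - fps_X) ^ e = fps_of_poly k" "F\<^sup>2 * (1 - fps_X) ^ e' = fps_of_poly k'"
    "poly k 1 \<noteq> 0" "poly k' 1 \<noteq> 0"
  shows "poly k' 1 = (poly k 1)\<^sup>2"
proof -
  let ?u = "[:1, -1:] :: int poly"
  have "fps_of_poly (k' * ?u ^ (2 * e)) = fps_of_poly (k\<^sup>2 * ?u ^ e')"
    unfolding fps_of_poly_mult fps_of_poly_power fps_of_poly_one_minus_X assms(1,2)[symmetric]
    unfolding power2_eq_square mult_2 power_add by (simp only: ac_simps)
  then have eq: "k' * ?u ^ (2 * e) = k\<^sup>2 * ?u ^ e'" by (simp only: fps_of_poly_eq_iff)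
  have u: "?u \<noteq> 0" "poly ?u 1 = 0" by simp_all
  consider "2 * e < e'" | "e' < 2 * e" | "2 * e = e'" by linarith
  then show ?thesis
  proof cases
    case 1
    then obtain j where j: "e' = 2 * e + Suc j" using less_iff_Suc_add[of "2 * e" e'] by auto
    have "?u ^ (2 * e) * k' = ?u ^ (2 * e) * (k\<^sup>2 * ?u ^ Suc j)"
      using eq unfolding j power_add by (simp only: ac_simps)
    then have "k' = k\<^sup>2 * ?u ^ Suc j" by (simp only: mult_left_cancel[OF power_not_zero[OF u(1)]])
    then have "poly k' 1 = 0" by simp
    then show ?thesis using assms(4) by simp
  next
    case 2
    then obtain j where j: "2 * e = e' + Suc j" using less_iff_Suc_add[of e' "2 * e"] by auto
    have "?u ^ e' * k\<^sup>2 = ?u ^ e' * (k' * ?u ^ Suc j)"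
      using eq unfolding j power_add by (simp only: ac_simps)
    then have "k\<^sup>2 = k' * ?u ^ Suc j" by (simp only: mult_left_cancel[OF power_not_zero[OF u(1)]])
    then have "poly (k\<^sup>2) 1 = 0" by simp
    then show ?thesis using assms(3) by simp
  next
    case 3
    then have "k' = k\<^sup>2" using eq u(1) by simp
    then show ?thesis by simp
  qed
qed

theorem theorem7p4:
  fixes n l :: nat and \<Delta> :: "nat set set"
  assumes "simplicial_complex {1..n} \<Delta>"
    and "l \<notin> {1..n}"
  shows "ideal_degree (Pow ({1..n} \<union> {l}))
           (toric_ideal ({1..n} \<union> {l}) (cone l \<Delta>) :: (nat set, 'k::field) mpoly set)
       = (ideal_degree (Pow {1..n}) (toric_ideal {1..n} \<Delta> :: (nat set, 'k) mpoly set))\<^sup>2"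
proof -
  have union: "{1..n} \<union> {l} = insert l {1..n}" by simp
  obtain k where k: "hilbert_series (Pow {1..n}) (toric_ideal {1..n} \<Delta> :: (nat set, 'k) mpoly set) *
      (1 - fps_X) ^ the_enat (krull_dim (poly_ring (Pow {1..n}) Quot (toric_ideal {1..n} \<Delta> :: (nat set, 'k) mpoly set))) =
      fps_of_poly k" "poly k 1 > 0"
    using hilbert_series_toric_ideal[OF assms(1)] by blast
  obtain k' where k': "hilbert_series (Pow (insert l {1..n})) (toric_ideal (insert l {1..n}) (cone l \<Delta>) :: (nat set, 'k) mpoly set) *
      (1 - fps_X) ^ the_enat (krull_dim (poly_ring (Pow (insert l {1..n})) Quot
        (toric_ideal (insert l {1..n}) (cone l \<Delta>) :: (nat set, 'k) mpoly set))) =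
      fps_of_poly k'" "poly k' 1 > 0"
    using hilbert_series_toric_ideal[OF simplicial_complex_cone[OF assms(1)]] by blast
  have "poly k' 1 = (poly k 1)\<^sup>2"
    using rational_square_value[OF k(1) k'(1)[unfolded hilbert_series_cone[OF assms]]] k(2) k'(2) by simp
  then show ?thesis
    unfolding union using ideal_degree_eqI[OF k] ideal_degree_eqI[OF k'] by simp
qed

end
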